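(* Let $u:\mathcal{S}\to\mathbb{R}$. The following properties are equivalent: (i) $u\in\mathrm{AMLE}(\mathcal{S})$; (ii) $u$ satisfies the Comparison with Cones property on $\mathcal{S}$; (iii) $u$ is infinity harmonic on $\mathcal{S}$.
   Context: Let $q_1,q_2,q_3\in\mathbb{R}^2$ be the vertices of an equilateral triangle of side $1$, $V^0=\{q_1,q_2,q_3\}$, and $\psi_i(x)=q_i+\frac12(x-q_i)$ for $i=1,2,3$. For $n\in\mathbb{N}$, $V^n=\bigcup \psi_{w_1}\circ\dots\circ\psi_{w_n}(V^0)$, the union over all words $w=(w_1,\dots,w_n)\in\{1,2,3\}^n$. The Sierpinski gasket $\mathcal{S}$ is the closure in $\mathbb{R}^2$ of $\bigcup_{n\ge0}V^n$. For $x,y\in V^n$ write $x\sim_n y$ iff the segment joining $x$ and $y$ is the image of a side of the initial triangle under some $\psi_{w_1}\circ\dots\circ\psi_{w_n}$. $\mathcal{S}$ is endowed with the path distance $d(x,y)=\inf\{\ell(\gamma):\gamma \text{ a path in }\mathcal{S}\text{ joining }x\text{ to }y\}$, $\ell(\gamma)$ being the length of $\gamma$. For $A\subset\mathcal{S}$ and a function $f$, $\mathrm{Lip}(f,A)=\sup_{x,y\in\overline A,\,x\ne y}\frac{|f(y)-f(x)|}{d(x,y)}$ ($\overline A$ and $\partial A$ are the topological closure and boundary in $\mathcal{S}$). $\mathrm{AMLE}(\mathcal{S})$ is the set of continuous $u:\mathcal{S}\to\mathbb{R}$ such that for every proper, open, connected set $A\subset\mathcal{S}\setminus V^0$ and every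 $v:\mathcal{S}\to\mathbb{R}$ with $u=v$ on $\partial A$ one has $\mathrm{Lip}(u,A)\le\mathrm{Lip}(v,A)$. $u:\mathcal{S}\to\mathbb{R}$ satisfies the Comparison with Cones property on $\mathcal{S}$ if for every proper, open, connected set $A\subset\mathcal{S}\setminus V^0$, every $x_0\in\mathcal{S}\setminus A$, $\lambda\ge0$ and $\alpha\in\mathbb{R}$: $u\le\lambda d(x_0,\cdot)+\alpha$ on $\partial A$ implies the same inequality on $A$, and $u\ge-\lambda d(x_0,\cdot)+\alpha$ on $\partial A$ implies the same inequality on $A$. A function $u^n:V^n\to\mathbb{R}$ is infinity harmonic if $\max_{y\sim_n x}\{u^n(y)-u^n(x)\}+\min_{y\sim_n x}\{u^n(y)-u^n(x)\}=0$ for all $x\in V^n\setminus V^0$. A function $u:\mathcal{S}\to\mathbb{R}$ is infinity harmonic on $\mathcal{S}$ if it is continuous and is the limit of infinity harmonic functions $u^n:V^n\to\mathbb{R}$ with $u^n=u$ on $V^0$, in the sense that $\lim_{n\to\infty}\sup_{x\in V^n}|u^n(x)-u(x)|=0$. *)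

theory Defs
  imports "HOL-Analysis.Analysis"
begin

text \<open>
  The vertices are a family \<open>q :: 3 \<Rightarrow> real^2\<close>, so that \<open>3\<close> is also the alphabet of the words.
  A function on the gasket is represented by a total function on the plane; every notion below
  depends only on its values on the gasket (or on the \<open>n\<close>-th vertex set).
\<close>

definition unit_equilateral :: "(3 \<Rightarrow> real^2) \<Rightarrow> bool" where
  "unit_equilateral q \<longleftrightarrow> (\<forall>i j. i \<noteq> j \<longrightarrow> dist (q i) (q j) = 1)"

definition psi :: "(3 \<Rightarrow> real^2) \<Rightarrow> 3 \<Rightarrow> real^2 \<Rightarrow> real^2" where
  "psi q i x = q i + (1/2) *\<^sub>R (x - q i)"

definition psi_word :: "(3 \<Rightarrow> real^2) \<Rightarrow> 3 list \<Rightarrow> real^2 \<Rightarrow> real^2" where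
  "psi_word q w = foldr (\<lambda>i f. psi q i \<circ> f) w id"

definition V :: "(3 \<Rightarrow> real^2) \<Rightarrow> nat \<Rightarrow> (real^2) set" where
  "V q n = (\<Union>w\<in>{w. length w = n}. psi_word q w ` range q)"

definition gasket :: "(3 \<Rightarrow> real^2) \<Rightarrow> (real^2) set" where
  "gasket q = closure (\<Union>n. V q n)"

definition adj :: "(3 \<Rightarrow> real^2) \<Rightarrow> nat \<Rightarrow> real^2 \<Rightarrow> real^2 \<Rightarrow> bool" where
  "adj q n x y \<longleftrightarrow> x \<in> V q n \<and> y \<in> V q n \<and>
     (\<exists>w i j. length w = n \<and> i \<noteq> j \<and>
        closed_segment x y = psi_word q w ` closed_segment (q i) (q j))"

text \<open>Length of a curve parametrised by \<open>[0,1]\<close>: the supremum, possibly infinite, of the lengths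
  of the inscribed polygons, taken over finite nondecreasing sequences of parameters.\<close>

definition path_length :: "(real \<Rightarrow> 'a::metric_space) \<Rightarrow> ennreal" where
  "path_length \<gamma> =
     (SUP (n, t) \<in> {(n, t :: nat \<Rightarrow> real). mono_on {..n} t \<and> t ` {..n} \<subseteq> {0..1}}.
        \<Sum>k<n. ennreal (dist (\<gamma> (t k)) (\<gamma> (t (Suc k)))))"

text \<open>Any two points of the gasket are joined by a curve of finite length inside it, so for them
  the conversion \<open>enn2real\<close> is never applied to infinity.\<close>

definition path_dist :: "(3 \<Rightarrow> real^2) \<Rightarrow> real^2 \<Rightarrow> real^2 \<Rightarrow> real" where
  "path_dist q x y = enn2real
     (INF \<gamma> \<in> {\<gamma>. path \<gamma> \<and> path_image \<gamma> \<subseteq> gasket q \<and> pathstart \<gamma> = x \<and> pathfinish \<gamma> = y}.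
        path_length \<gamma>)"

text \<open>The path metric and the Euclidean metric are equivalent on the gasket, so closure,
  boundary, openness and continuity are those of the subspace topology of the plane.\<close>

abbreviation gasket_top :: "(3 \<Rightarrow> real^2) \<Rightarrow> (real^2) topology" where
  "gasket_top q \<equiv> top_of_set (gasket q)"

definition Lip :: "(3 \<Rightarrow> real^2) \<Rightarrow> (real^2 \<Rightarrow> real) \<Rightarrow> (real^2) set \<Rightarrow> ennreal" where
  "Lip q f A =
     (SUP (x, y) \<in> {(x, y). x \<in> gasket_top q closure_of A \<and> y \<in> gasket_top q closure_of A \<and> x \<noteq> y}.
        ennreal (\<bar>f y - f x\<bar> / path_dist q x y))"

definition admissible :: "(3 \<Rightarrow> real^2) \<Rightarrow> (real^2) set \<Rightarrow> bool" where
  "admissible q A \<longleftrightarrow>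
     A \<subset> gasket q \<and> openin (gasket_top q) A \<and> connected A \<and> A \<subseteq> gasket q - V q 0"

text \<open>The competitor \<open>v\<close> is arbitrary: neither continuous nor Lipschitz, hence the extended value
  of \<open>Lip\<close>.\<close>

definition AMLE :: "(3 \<Rightarrow> real^2) \<Rightarrow> (real^2 \<Rightarrow> real) set" where
  "AMLE q = {u. continuous_on (gasket q) u \<and>
     (\<forall>A v. admissible q A \<longrightarrow> (\<forall>x\<in>gasket_top q frontier_of A. u x = v x) \<longrightarrow>
        Lip q u A \<le> Lip q v A)}"

definition comparison_with_cones :: "(3 \<Rightarrow> real^2) \<Rightarrow> (real^2 \<Rightarrow> real) \<Rightarrow> bool" where
  "comparison_with_cones q u \<longleftrightarrow>
     (\<forall>A x0 l a. admissible q A \<longrightarrow> x0 \<in> gasket q - A \<longrightarrow> 0 \<le> l \<longrightarrow>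
        ((\<forall>x\<in>gasket_top q frontier_of A. u x \<le> l * path_dist q x0 x + a) \<longrightarrow>
           (\<forall>x\<in>A. u x \<le> l * path_dist q x0 x + a)) \<and>
        ((\<forall>x\<in>gasket_top q frontier_of A. u x \<ge> - l * path_dist q x0 x + a) \<longrightarrow>
           (\<forall>x\<in>A. u x \<ge> - l * path_dist q x0 x + a)))"

definition graph_infinity_harmonic ::
    "(3 \<Rightarrow> real^2) \<Rightarrow> nat \<Rightarrow> (real^2 \<Rightarrow> real) \<Rightarrow> bool" where
  "graph_infinity_harmonic q n f \<longleftrightarrow>
     (\<forall>x\<in>V q n - V q 0.
        (MAX y\<in>{y. adj q n x y}. f y - f x) + (MIN y\<in>{y. adj q n x y}. f y - f x) = 0)"

definition infinity_harmonic :: "(3 \<Rightarrow> real^2) \<Rightarrow> (real^2 \<Rightarrow> real) \<Rightarrow> bool" where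
  "infinity_harmonic q u \<longleftrightarrow> continuous_on (gasket q) u \<and>
     (\<exists>un :: nat \<Rightarrow> real^2 \<Rightarrow> real.
        (\<forall>n. graph_infinity_harmonic q n (un n) \<and> (\<forall>x\<in>V q 0. un n x = u x)) \<and>
        (\<lambda>n. SUP x\<in>V q n. \<bar>un n x - u x\<bar>) \<longlonglongrightarrow> 0)"

end

theory Submission
  imports Defs "HOL-Complex_Analysis.Great_Picard"
begin

text \<open>
  Both continuum properties are one-sided statements invariant under \<open>u \<mapsto> - u\<close>, so only upper bounds
  have to be considered. The gasket is a length space that is locally connected: any two points are
  joined by curves whose length is as close as desired to their distance, and a curve that leaves a
  set meets its frontier (\<open>exit_point\<close>). This gives the equivalence of absolute minimality and
  comparison with cones as in Euclidean space. If \<open>u\<close> exceeded a cone with the same values on the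
  frontier of some set, the Lipschitz constant of \<open>u\<close> there would be at most the slope of the cone,
  and following a nearly shortest curve to the vertex of the cone gives a contradiction
  (\<open>AMLE_comparison_from_above\<close>). Conversely, comparison with cones centred at frontier points,
  and then at points of the set after removing them from it, propagates a Lipschitz bound from the
  frontier to the set (\<open>comparison_lipschitz\<close>); in particular it makes \<open>u\<close> globally Lipschitz.

  The link with the graphs is that distinct cells of level \<open>n\<close> meet only in corners. Hence a curve
  leaves the union of the cells at a vertex \<open>x\<close> only through a neighbour of \<open>x\<close>, and every other
  vertex of level \<open>n\<close> is strictly nearer, by the full edge length \<open>2\<^sup>-\<^sup>n\<close>, to some neighbour of \<open>x\<close> than to \<open>x\<close>
  itself (\<open>nearer_neighbour\<close>). Consequently cones restricted to the vertices are infinity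
  superharmonic on the graph away from their centre (\<open>cone_supersolution\<close>), and the comparison
  principle for finite graphs (\<open>graph_comparison\<close>) carries comparison with cones from discrete
  infinity harmonic functions to their uniform limits.

  For the converse let \<open>u\<close> satisfy comparison with cones and let \<open>U\<close> assign to a vertex of level \<open>n\<close>
  the maximum of \<open>u\<close> over its neighbours. Comparing \<open>u\<close> with a cone on the ball of radius two edges
  shows that \<open>U\<close> is infinity subharmonic on the graph (\<open>nbmax_subharmonic\<close>); this is the
  discretisation of Armstrong and Smart's proof of Jensen's uniqueness theorem. The discrete infinity
  harmonic function \<open>f\<close> with the boundary values of \<open>u\<close>, which exists by Perron's method, therefore
  satisfies \<open>u \<le> U \<le> f + 3 L 2\<^sup>-\<^sup>n\<close> at the interior vertices without neighbour in \<open>V\<^sup>0\<close>, \<open>L\<close> being a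
  Lipschitz constant of \<open>u\<close>; the bound of \<open>u\<close> extends to the remaining vertices because both
  functions are controlled by cones at \<open>V\<^sup>0\<close>. The same bound for \<open>- u\<close> shows that the discrete
  solutions converge to \<open>u\<close>.
\<close>

section \<open>Words and vertex sets\<close>

lemma tendsto_divide_power2: "(\<lambda>n. C / 2 ^ n) \<longlonglongrightarrow> (0::real)"
proof -
  have "(\<lambda>n. C * (1/2) ^ n) \<longlonglongrightarrow> C * 0"
    by (intro tendsto_intros LIMSEQ_power_zero) auto
  then show ?thesis by (simp add: power_one_over)
qed

lemma small_power:
  fixes C e :: real
  assumes "0 < e" obtains n where "C / 2 ^ n < e"
  using order_tendstoD(2)[OF tendsto_divide_power2 assms, of C] by (auto simp: eventually_sequentially)

lemma psi_word_Nil [simp]: "psi_word q [] = id"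
  by (simp add: psi_word_def)

lemma psi_word_Cons [simp]: "psi_word q (i # w) x = psi q i (psi_word q w x)"
  by (simp add: psi_word_def)

lemma psi_alt: "psi q i x = (1/2) *\<^sub>R (q i + x)"
  by (simp add: vec_eq_iff psi_def field_simps)

lemma psi_word_affine: "psi_word q w x = psi_word q w 0 + (1 / 2 ^ length w) *\<^sub>R x"
  by (induction w) (auto simp: vec_eq_iff psi_alt field_simps)

lemma dist_psi: "dist (psi q i x) (psi q i y) = dist x y / 2"
proof -
  have "psi q i x - psi q i y = (1/2) *\<^sub>R (x - y)"
    by (simp add: psi_alt algebra_simps)
  then show ?thesis by (simp add: dist_norm)
qed

lemma dist_psi_word: "dist (psi_word q w x) (psi_word q w y) = dist x y / 2 ^ length w"
  by (induction w) (auto simp: dist_psi)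

lemma inj_psi_word: "psi_word q w x = psi_word q w y \<longleftrightarrow> x = y"
  by (metis dist_psi_word dist_eq_0_iff divide_eq_0_iff power_not_zero zero_neq_numeral)

lemma psi_fixed [simp]: "psi q i (q i) = q i"
  by (simp add: psi_def)

lemma psi_word_image_closed_segment:
  "psi_word q w ` closed_segment x y = closed_segment (psi_word q w x) (psi_word q w y)"
proof -
  let ?f = "\<lambda>x. (1 / 2 ^ length w) *\<^sub>R (x :: real^2)" and ?a = "psi_word q w 0"
  have "psi_word q w ` closed_segment x y = (+) ?a ` ?f ` closed_segment x y"
    unfolding image_image by (intro image_cong psi_word_affine refl)
  also have "\<dots> = (+) ?a ` closed_segment (?f x) (?f y)"
    by (simp add: closed_segment_linear_image linear_scaleR)
  also have "\<dots> = closed_segment (?a + ?f x) (?a + ?f y)"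
    by (rule closed_segment_translation[symmetric])
  finally show ?thesis by (simp only: psi_word_affine[symmetric])
qed

lemma V_0: "V q 0 = range q"
  by (auto simp: V_def)

lemma V_Suc: "V q (Suc n) = (\<Union>i. psi q i ` V q n)"
proof -
  have "{w::3 list. length w = Suc n} = (\<Union>i. Cons i ` {w. length w = n})"
    by (auto simp: length_Suc_conv)
  then have "V q (Suc n) = (\<Union>i. \<Union>w\<in>{w. length w = n}. psi_word q (i # w) ` range q)"
    by (simp add: V_def)
  also have "\<dots> = (\<Union>i. psi q i ` V q n)"
    by (simp add: V_def image_UN image_image)
  finally show ?thesis .
qed

lemma finite_V: "finite (V q n)"
  by (induction n) (auto simp: V_0 V_Suc)

lemma V_nonempty: "V q n \<noteq> {}"
  by (induction n) (auto simp: V_0 V_Suc)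

lemma V_mono: "m \<le> n \<Longrightarrow> V q m \<subseteq> V q n"
proof (rule lift_Suc_mono_le[of "V q"])
  fix n show "V q n \<subseteq> V q (Suc n)"
  proof (induction n)
    case 0
    have "q i \<in> psi q i ` range q" for i by (metis psi_fixed rangeI image_eqI)
    then show ?case by (auto simp only: V_0 V_Suc)
  next
    case (Suc n)
    then have "(\<Union>i. psi q i ` V q n) \<subseteq> (\<Union>i. psi q i ` V q (Suc n))" by blast
    then show ?case by (simp only: V_Suc)
  qed
qed

lemma V_subset_gasket: "V q n \<subseteq> gasket q"
  unfolding gasket_def by (rule order_trans[OF UN_upper[OF UNIV_I] closure_subset])

lemma closed_gasket: "closed (gasket q)"
  by (simp add: gasket_def)

section \<open>The gasket as a self-similar set\<close>

lemma closure_psi_image: "closure (psi q i ` A) = psi q i ` closure A"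
proof -
  have "psi q i = (\<lambda>x. (1/2) *\<^sub>R q i + x) \<circ> (\<lambda>x. (1 / 2) *\<^sub>R x)"
    by (rule ext) (simp add: psi_alt scaleR_add_right)
  then show ?thesis
    by (metis closure_translation closure_scaleR image_comp)
qed

lemma gasket_Union_psi: "gasket q = (\<Union>i. psi q i ` gasket q)"
proof -
  have "(\<Union>n. V q n) = (\<Union>n. V q (Suc n))"
  proof (rule antisym)
    show "(\<Union>n. V q n) \<subseteq> (\<Union>n. V q (Suc n))"
      by (rule UN_mono[OF order_refl V_mono]) simp
    show "(\<Union>n. V q (Suc n)) \<subseteq> (\<Union>n. V q n)"
      by auto
  qed
  also have "\<dots> = (\<Union>i. psi q i ` (\<Union>n. V q n))"
    by (simp only: V_Suc image_UN) blast
  finally have "gasket q = closure (\<Union>i. psi q i ` (\<Union>n. V q n))"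
    unfolding gasket_def by (rule arg_cong)
  also have "\<dots> = (\<Union>i. closure (psi q i ` (\<Union>n. V q n)))"
    by (simp add: UNIV_3)
  finally show ?thesis
    unfolding closure_psi_image by (simp add: gasket_def[symmetric])
qed

definition cell :: "(3 \<Rightarrow> real^2) \<Rightarrow> 3 list \<Rightarrow> (real^2) set" where
  "cell q w = psi_word q w ` gasket q"

definition corners :: "(3 \<Rightarrow> real^2) \<Rightarrow> 3 list \<Rightarrow> (real^2) set" where
  "corners q w = psi_word q w ` range q"

lemma cell_Cons: "cell q (i # w) = psi q i ` cell q w"
  by (auto simp: cell_def)

lemma corners_Cons: "corners q (i # w) = psi q i ` corners q w"
  by (auto simp: corners_def)

lemma gasket_eq_Union_cells: "gasket q = (\<Union>w\<in>{w. length w = n}. cell q w)"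
proof (induction n)
  case 0 show ?case by (auto simp: cell_def)
next
  case (Suc n)
  have *: "{w::3 list. length w = Suc n} = (\<Union>i. Cons i ` {w. length w = n})"
    by (auto simp: length_Suc_conv)
  have "gasket q = (\<Union>i. psi q i ` gasket q)" by (rule gasket_Union_psi)
  also have "\<dots> = (\<Union>i. psi q i ` (\<Union>w\<in>{w. length w = n}. cell q w))" by (simp only: flip: Suc)
  also have "\<dots> = (\<Union>w\<in>{w. length w = Suc n}. cell q w)" by (auto simp: * cell_Cons)
  finally show ?case .
qed

lemma cell_subset_gasket: "cell q w \<subseteq> gasket q"
  by (subst gasket_eq_Union_cells[of q "length w"]) auto

lemma V_eq_Union_corners: "V q n = (\<Union>w\<in>{w. length w = n}. corners q w)"
  by (simp add: V_def corners_def)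

lemma corners_subset_V: "corners q w \<subseteq> V q (length w)"
  by (auto simp: V_eq_Union_corners)

lemma vertex_in_gasket: "q i \<in> gasket q"
  using V_subset_gasket[of q 0] by (auto simp: V_0)

lemma corners_subset_cell: "corners q w \<subseteq> cell q w"
  using vertex_in_gasket by (auto simp: corners_def cell_def)

lemma finite_words: "finite {w :: 3 list. length w = n}"
  using finite_lists_length_eq[of "UNIV :: 3 set" n] by simp

lemma closed_cell: "closed (cell q w)"
proof -
  have "closed (psi q i ` A)" if "closed A" for A i
    using closure_psi_image[of q i A] that by (metis closure_closed closed_closure)
  then show ?thesis
    by (induction w) (auto simp: cell_Cons cell_def[of q "[]"] closed_gasket)
qed

text \<open>Iterating the inclusion writes a point of \<open>K\<close> as the image of another point of \<open>K\<close> under a word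
  of length \<open>n\<close>, hence puts it within a constant times \<open>2\<^sup>-\<^sup>n\<close> of a vertex of level \<open>n\<close>.\<close>

lemma subset_gasketI:
  assumes K: "K \<subseteq> (\<Union>i. psi q i ` K)" and "bounded K"
  shows "K \<subseteq> gasket q"
proof
  fix p assume "p \<in> K"
  obtain B where B: "\<And>x. x \<in> K \<Longrightarrow> dist (q 1) x \<le> B"
    using \<open>bounded K\<close> bounded_any_center[of K "q 1"] by blast
  have word: "\<exists>w x. length w = n \<and> x \<in> K \<and> p = psi_word q w x" if "p \<in> K" for n p
    using that
  proof (induction n arbitrary: p)
    case 0 then show ?case by auto
  next
    case (Suc n)
    from K Suc.prems obtain i y where y: "y \<in> K" "p = psi q i y" by blast
    from Suc.IH[OF y(1)] obtain w x where "length w = n" "x \<in> K" "y = psi_word q w x" by blast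
    then show ?case using y by (intro exI[of _ "i # w"] exI[of _ x]) auto
  qed
  show "p \<in> gasket q"
    unfolding gasket_def closure_approachable
  proof (intro allI impI)
    fix e :: real assume "0 < e"
    obtain n where n: "B / 2 ^ n < e" using small_power[OF \<open>0 < e\<close>] .
    obtain w x where w: "length w = n" "x \<in> K" "p = psi_word q w x"
      using word[OF \<open>p \<in> K\<close>] by blast
    have "dist (psi_word q w (q 1)) p = dist (q 1) x / 2 ^ n"
      by (simp add: w dist_psi_word)
    also have "\<dots> \<le> B / 2 ^ n" using B[OF w(2)] by (simp add: divide_right_mono)
    also have "\<dots> < e" by (rule n)
    finally show "\<exists>y\<in>\<Union>n. V q n. dist y p < e"
      using corners_subset_V[of q w] unfolding corners_def by blast
  qed
qed

lemma segment_subset_gasket: "closed_segment (q i) (q j) \<subseteq> gasket q"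
proof (rule subset_gasketI)
  show "closed_segment (q i) (q j) \<subseteq> (\<Union>k. psi q k ` closed_segment (q i) (q j))"
  proof
    fix p assume "p \<in> closed_segment (q i) (q j)"
    then obtain t where t: "0 \<le> t" "t \<le> 1" "p = (1 - t) *\<^sub>R q i + t *\<^sub>R q j"
      by (auto simp: closed_segment_def)
    show "p \<in> (\<Union>k. psi q k ` closed_segment (q i) (q j))"
    proof (cases "t \<le> 1/2")
      case True
      have "p = psi q i ((1 - 2*t) *\<^sub>R q i + (2*t) *\<^sub>R q j)"
        by (simp add: t psi_alt vec_eq_iff field_simps)
      moreover have "(1 - 2*t) *\<^sub>R q i + (2*t) *\<^sub>R q j \<in> closed_segment (q i) (q j)"
        using t True by (auto simp: closed_segment_def)
      ultimately show ?thesis by blast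
    next
      case False
      have "p = psi q j ((1 - (2*t-1)) *\<^sub>R q i + (2*t-1) *\<^sub>R q j)"
        by (simp add: t psi_alt vec_eq_iff field_simps)
      moreover have "(1 - (2*t-1)) *\<^sub>R q i + (2*t-1) *\<^sub>R q j \<in> closed_segment (q i) (q j)"
        using t False unfolding closed_segment_def by (auto intro!: exI[of _ "2*t-1"])
      ultimately show ?thesis by blast
    qed
  qed
qed (rule compact_imp_bounded, rule compact_segment)

section \<open>Cells of the same level meet only in corners\<close>

text \<open>The barycentric coordinate belonging to the vertex \<open>q j\<close>. In an equilateral triangle of side \<open>1\<close> its
  gradient is twice the vector from the centroid to that vertex.\<close>

definition bary :: "(3 \<Rightarrow> real^2) \<Rightarrow> 3 \<Rightarrow> real^2 \<Rightarrow> real" where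
  "bary q j x = 1/3 + 2 * ((x - (1/3) *\<^sub>R (\<Sum>k\<in>UNIV. q k)) \<bullet> (q j - (1/3) *\<^sub>R (\<Sum>k\<in>UNIV. q k)))"

text \<open>The convex hull of the vertices; the second condition makes a point determined by its coordinates.\<close>

definition solid_triangle :: "(3 \<Rightarrow> real^2) \<Rightarrow> (real^2) set" where
  "solid_triangle q = {x. (\<forall>k. 0 \<le> bary q k x) \<and> x = (\<Sum>k\<in>UNIV. bary q k x *\<^sub>R q k)}"

locale sierpinski =
  fixes q :: "3 \<Rightarrow> real^2"
  assumes equilateral: "unit_equilateral q"
begin

lemma dist_vertices: "i \<noteq> j \<Longrightarrow> dist (q i) (q j) = 1"
  using equilateral by (auto simp: unit_equilateral_def)

lemma vertex_eq_iff [simp]: "q i = q j \<longleftrightarrow> i = j"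
  using dist_vertices[of i j] by (cases "i = j") auto

lemma sum_bary: "(\<Sum>k\<in>UNIV. bary q k x) = 1"
proof -
  let ?c = "(1/3) *\<^sub>R (\<Sum>k\<in>UNIV. q k)"
  have "(\<Sum>k\<in>UNIV. bary q k x) = 1 + 2 * ((x - ?c) \<bullet> (\<Sum>k\<in>UNIV. q k - ?c))"
    by (simp add: bary_def sum.distrib inner_sum_right sum_distrib_left)
  also have "(\<Sum>k\<in>UNIV. q k - ?c) = 0"
    by (simp add: sum_subtractf sum_constant_scaleR)
  finally show ?thesis by simp
qed

lemma bary_vertex: "bary q j (q i) = (if i = j then 1 else 0)"
proof -
  have d: "(q i - q j) \<bullet> (q i - q j) = (if i = j then 0 else 1)" for i j
    using dist_vertices[of i j] by (auto simp: dist_norm norm_eq_1)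
  note D = d[of 1 2] d[of 1 3] d[of 2 3]
  have D': "q 1 \<bullet> q 1 + q 2 \<bullet> q 2 - 2 * (q 1 \<bullet> q 2) = 1"
    "q 1 \<bullet> q 1 + q 3 \<bullet> q 3 - 2 * (q 1 \<bullet> q 3) = 1"
    "q 2 \<bullet> q 2 + q 3 \<bullet> q 3 - 2 * (q 2 \<bullet> q 3) = 1"
    using D by (simp_all add: inner_diff_left inner_diff_right inner_commute)
  have "\<forall>i j. bary q j (q i) = (if i = j then 1 else 0)"
    unfolding forall_3 bary_def sum_3 using D'
    by (simp add: inner_diff_left inner_diff_right inner_add_left inner_add_right inner_commute algebra_simps)
  then show ?thesis by blast
qed

lemma bary_psi: "bary q j (psi q i x) = (bary q j x + (if i = j then 1 else 0)) / 2"
proof -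
  have "bary q j (psi q i x) = (bary q j x + bary q j (q i)) / 2"
    by (simp add: bary_def psi_alt inner_diff_left inner_add_left field_simps)
  then show ?thesis by (simp add: bary_vertex)
qed

lemma bary_le_1: "x \<in> solid_triangle q \<Longrightarrow> bary q k x \<le> 1"
  using sum_bary[of x] member_le_sum[of k UNIV "\<lambda>k. bary q k x"] by (auto simp: solid_triangle_def)

text \<open>The other coordinates are nonnegative and the coordinates sum to \<open>1\<close>, so the others vanish.\<close>

lemma triangle_eq_vertex:
  assumes x: "x \<in> solid_triangle q" and 1: "bary q k x \<ge> 1"
  shows "x = q k"
proof -
  have "(\<Sum>j\<in>UNIV. bary q j x) = bary q k x + (\<Sum>j\<in>UNIV - {k}. bary q j x)"
    by (simp add: sum.remove)
  with 1 sum_bary[of x] have "(\<Sum>j\<in>UNIV - {k}. bary q j x) \<le> 0" by simp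
  moreover have nn: "\<And>j. 0 \<le> bary q j x" using x by (auto simp: solid_triangle_def)
  ultimately have "(\<Sum>j\<in>UNIV - {k}. bary q j x) = 0"
    by (meson antisym sum_nonneg)
  then have 0: "bary q j x = 0" if "j \<noteq> k" for j
    using nn that by (subst (asm) sum_nonneg_eq_0_iff) auto
  then have "bary q k x = 1"
    using sum_bary[of x] by (simp add: sum.remove[of UNIV k])
  moreover have "x = (\<Sum>j\<in>UNIV. bary q j x *\<^sub>R q j)" using x by (simp add: solid_triangle_def)
  ultimately show ?thesis using 0 by (simp add: sum.remove[of UNIV k])
qed

lemma psi_solid_triangle: 
  assumes "x \<in> solid_triangle q" shows "psi q i x \<in> solid_triangle q"
proof -
  have x: "x = (\<Sum>k\<in>UNIV. bary q k x *\<^sub>R q k)" using assms by (simp add: solid_triangle_def)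
  have "(\<Sum>k\<in>UNIV. bary q k (psi q i x) *\<^sub>R q k)
      = (\<Sum>k\<in>UNIV. (1/2) *\<^sub>R (bary q k x *\<^sub>R q k) + (if k = i then (1/2) *\<^sub>R q k else 0))"
    by (rule sum.cong) (auto simp: bary_psi algebra_simps add_divide_distrib)
  also have "\<dots> = (1/2) *\<^sub>R (\<Sum>k\<in>UNIV. bary q k x *\<^sub>R q k) + (1/2) *\<^sub>R q i"
    by (simp add: sum.distrib scaleR_sum_right)
  also have "\<dots> = (1/2) *\<^sub>R x + (1/2) *\<^sub>R q i"
    by (simp only: x[symmetric])
  also have "\<dots> = psi q i x"
    by (simp add: psi_alt scaleR_add_right add.commute)
  finally show ?thesis using assms by (auto simp: solid_triangle_def bary_psi)
qed

lemma closed_triangle: "closed (solid_triangle q)"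
proof -
  have c: "continuous_on UNIV (bary q k)" for k
    unfolding bary_def by (intro continuous_intros)
  have "solid_triangle q = (\<Inter>k. {x. 0 \<le> bary q k x}) \<inter> {x. x = (\<Sum>k\<in>UNIV. bary q k x *\<^sub>R q k)}"
    by (auto simp: solid_triangle_def)
  moreover have "closed \<dots>"
    by (intro closed_Int closed_INT ballI closed_Collect_le closed_Collect_eq continuous_intros c)
  ultimately show ?thesis by simp
qed

lemma gasket_subset_triangle: "gasket q \<subseteq> solid_triangle q"
proof -
  have "V q n \<subseteq> solid_triangle q" for n
  proof (induction n)
    case 0 show ?case by (auto simp: V_0 solid_triangle_def bary_vertex if_distrib[of "\<lambda>c. c *\<^sub>R _"] cong: if_cong)
  next
    case (Suc n) then show ?case by (auto simp: V_Suc psi_solid_triangle)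
  qed
  then show ?thesis unfolding gasket_def by (meson UN_least closed_triangle closure_minimal)
qed

lemma bounded_triangle: "bounded (solid_triangle q)"
proof (rule boundedI)
  fix x assume x: "x \<in> solid_triangle q"
  have "norm x = norm (\<Sum>k\<in>UNIV. bary q k x *\<^sub>R q k)" using x by (simp add: solid_triangle_def)
  also have "\<dots> \<le> (\<Sum>k\<in>UNIV. norm (q k))"
    using x bary_le_1[OF x] 
    by (intro sum_norm_le) (auto simp: solid_triangle_def intro!: mult_left_le_one_le)
  finally show "norm x \<le> (\<Sum>k\<in>UNIV. norm (q k))" .
qed

lemma compact_gasket: "compact (gasket q)"
  using bounded_subset[OF bounded_triangle gasket_subset_triangle] closed_gasket
  by (simp add: compact_eq_bounded_closed)

text \<open>The map \<open>psi q i\<close> halves the coordinate \<open>j\<close> and adds a half only if \<open>i = j\<close>. So the value \<open>1\<close> at \<open>q j\<close>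
  comes from \<open>i = j\<close> and the value \<open>1\<close> again, and this descends along the word.\<close>

lemma vertex_in_cell: 
  assumes "q j \<in> cell q w" shows "q j \<in> corners q w"
  using assms
proof (induction w)
  case Nil then show ?case by (simp add: corners_def)
next
  case (Cons i w)
  then obtain x where x: "x \<in> cell q w" "q j = psi q i x" by (auto simp: cell_Cons)
  have xt: "x \<in> solid_triangle q" using x(1) cell_subset_gasket gasket_subset_triangle by blast
  have "1 = (bary q j x + (if i = j then 1 else 0)) / 2"
    using bary_psi[of j i x] by (simp add: bary_vertex flip: x(2))
  then have "i = j" "bary q j x = 1" using bary_le_1[OF xt, of j] by (auto split: if_splits)
  then have "x = q j" using triangle_eq_vertex xt by auto
  then show ?case using Cons.IH x by (auto simp: corners_Cons)
qed

text \<open>In the image under \<open>psi q i\<close> the coordinate \<open>j\<close> is at most a half, in the image under \<open>psi q j\<close> at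
  least a half; equality forces the coordinate of \<open>x\<close> to be \<open>1\<close>.\<close>

lemma psi_overlap:
  assumes "x \<in> solid_triangle q" "y \<in> solid_triangle q" "i \<noteq> j" "psi q i x = psi q j y"
  shows "x = q j"
proof -
  have "bary q j x / 2 = (bary q j y + 1) / 2"
    using bary_psi[of j i x] bary_psi[of j j y] assms by simp
  moreover have "0 \<le> bary q j y" using assms(2) by (simp add: solid_triangle_def)
  ultimately show ?thesis using triangle_eq_vertex assms(1) by auto
qed

text \<open>A common prefix of the words cancels by injectivity. At the first differing letter the point is
  the image of a vertex, which lies in the remaining cell only as a corner.\<close>

lemma cells_overlap:
  assumes "length v = length w" "v \<noteq> w" "p \<in> cell q v" "p \<in> cell q w"
  shows "p \<in> corners q v"
  using assms
proof (induction v w arbitrary: p rule: list_induct2)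
  case Nil then show ?case by simp
next
  case (Cons i v j w)
  obtain x y where xy: "x \<in> cell q v" "p = psi q i x" "y \<in> cell q w" "p = psi q j y"
    using Cons.prems by (auto simp: cell_Cons)
  show ?case
  proof (cases "i = j")
    case True
    then have "x = y" using xy inj_psi_word[of q "[i]" x y] by simp
    then show ?thesis using Cons xy True by (auto simp: corners_Cons)
  next
    case False
    then have "x = q j"
      using psi_overlap[of x y i j] xy cell_subset_gasket gasket_subset_triangle by blast
    then show ?thesis using xy vertex_in_cell by (auto simp: corners_Cons)
  qed
qed

lemma V_Int_cell:
  assumes "p \<in> V q (length w)" "p \<in> cell q w" shows "p \<in> corners q w"
proof -
  obtain v where "length v = length w" "p \<in> corners q v"
    using assms(1) by (auto simp: V_eq_Union_corners)
  then show ?thesis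
    using cells_overlap[of w v p] corners_subset_cell assms(2) by (cases "v = w") auto
qed

end

section \<open>Length of curves\<close>

lemma polygon_le_path_length:
  "mono_on {..n} t \<Longrightarrow> t ` {..n} \<subseteq> {0..1} \<Longrightarrow>
     (\<Sum>k<n. ennreal (dist (\<gamma> (t k)) (\<gamma> (t (Suc k))))) \<le> path_length \<gamma>"
  unfolding path_length_def by (rule SUP_upper2[of "(n, t)"]) auto

lemma path_length_leI:
  assumes "\<And>n t. mono_on {..n} t \<Longrightarrow> t ` {..n} \<subseteq> {0..1} \<Longrightarrow>
     (\<Sum>k<n. ennreal (dist (\<gamma> (t k)) (\<gamma> (t (Suc k))))) \<le> C"
  shows "path_length \<gamma> \<le> C"
  unfolding path_length_def using assms by (auto intro!: SUP_least)

lemma dist_le_path_length: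
  assumes "0 \<le> s" "s \<le> t" "t \<le> 1"
  shows "ennreal (dist (\<gamma> s) (\<gamma> t)) \<le> path_length \<gamma>"
  using polygon_le_path_length[of 1 "\<lambda>k. if k = 0 then s else t" \<gamma>] assms
  by (auto simp: mono_on_def image_subset_iff)

lemma path_length_lipschitz:
  assumes "L-lipschitz_on {0..1} \<gamma>"
  shows "path_length \<gamma> \<le> ennreal L"
proof (rule path_length_leI)
  fix n and t :: "nat \<Rightarrow> real" assume t: "mono_on {..n} t" "t ` {..n} \<subseteq> {0..1}"
  have L: "0 \<le> L" using assms lipschitz_on_nonneg by blast
  have "(\<Sum>k<n. dist (\<gamma> (t k)) (\<gamma> (t (Suc k)))) \<le> (\<Sum>k<n. L * (t (Suc k) - t k))"
  proof (rule sum_mono)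
    fix k assume "k \<in> {..<n}"
    then have "t k \<le> t (Suc k)" "t k \<in> {0..1}" "t (Suc k) \<in> {0..1}"
      using t by (auto simp: mono_on_def image_subset_iff)
    then show "dist (\<gamma> (t k)) (\<gamma> (t (Suc k))) \<le> L * (t (Suc k) - t k)"
      using lipschitz_onD[OF assms, of "t k" "t (Suc k)"] by (simp add: dist_real_def)
  qed
  also have "\<dots> = L * (t n - t 0)"
    by (simp add: sum_lessThan_telescope flip: sum_distrib_left)
  also have "\<dots> \<le> L * 1"
  proof (intro mult_left_mono L)
    have "t n \<in> {0..1}" "t 0 \<in> {0..1}" using t(2) by auto
    then show "t n - t 0 \<le> 1" by simp
  qed
  finally show "(\<Sum>k<n. ennreal (dist (\<gamma> (t k)) (\<gamma> (t (Suc k))))) \<le> ennreal L"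
    by (simp add: L)
qed

text \<open>Clamping the parameters of a polygon to either half of the interval gives one polygon for each
  curve; an edge across the middle is dominated by the sum of its two parts.\<close>

lemma path_length_join:
  assumes "pathfinish g1 = pathstart g2"
  shows "path_length (g1 +++ g2) \<le> path_length g1 + path_length g2"
proof (rule path_length_leI)
  fix n and t :: "nat \<Rightarrow> real" assume t: "mono_on {..n} t" "t ` {..n} \<subseteq> {0..1}"
  define s where "s = (\<lambda>k. 2 * min (t k) (1/2))"
  define r where "r = (\<lambda>k. 2 * max (t k) (1/2) - 1)"
  have "s i \<le> s j" "r i \<le> r j" if "i \<le> j" "j \<le> n" for i j
  proof -
    have "t i \<le> t j" using t(1) that by (auto simp: mono_on_def)
    then show "s i \<le> s j" "r i \<le> r j" by (auto simp: s_def r_def)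
  qed
  moreover have "s k \<in> {0..1}" "r k \<in> {0..1}" if "k \<le> n" for k
  proof -
    have "t k \<in> {0..1}" using t(2) that by auto
    then show "s k \<in> {0..1}" "r k \<in> {0..1}" by (auto simp: s_def r_def max_def)
  qed
  ultimately have sr: "mono_on {..n} s" "mono_on {..n} r" "s ` {..n} \<subseteq> {0..1}" "r ` {..n} \<subseteq> {0..1}"
    by (auto simp: mono_on_def)
  have eq: "g1 1 = g2 0" using assms by (simp add: pathfinish_def pathstart_def)
  have "(\<Sum>k<n. ennreal (dist ((g1 +++ g2) (t k)) ((g1 +++ g2) (t (Suc k)))))
      \<le> (\<Sum>k<n. ennreal (dist (g1 (s k)) (g1 (s (Suc k)))) + ennreal (dist (g2 (r k)) (g2 (r (Suc k)))))"
  proof (rule sum_mono)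
    fix k assume "k \<in> {..<n}"
    then have le: "t k \<le> t (Suc k)" using t by (auto simp: mono_on_def)
    have "dist ((g1 +++ g2) (t k)) ((g1 +++ g2) (t (Suc k)))
        \<le> dist (g1 (s k)) (g1 (s (Suc k))) + dist (g2 (r k)) (g2 (r (Suc k)))"
      using le dist_triangle[of "g1 (2 * t k)" "g2 (2 * t (Suc k) - 1)" "g2 0"]
      by (auto simp: joinpaths_def s_def r_def min_def max_def eq)
    then show "ennreal (dist ((g1 +++ g2) (t k)) ((g1 +++ g2) (t (Suc k))))
        \<le> ennreal (dist (g1 (s k)) (g1 (s (Suc k)))) + ennreal (dist (g2 (r k)) (g2 (r (Suc k))))"
      by (simp add: ennreal_leI flip: ennreal_plus)
  qed
  also have "\<dots> \<le> path_length g1 + path_length g2"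
    unfolding sum.distrib by (intro add_mono polygon_le_path_length sr)
  finally show "(\<Sum>k<n. ennreal (dist ((g1 +++ g2) (t k)) ((g1 +++ g2) (t (Suc k))))) \<le> path_length g1 + path_length g2" .
qed

lemma path_length_reversepath: "path_length (reversepath g) \<le> path_length g"
proof (rule path_length_leI)
  fix n and t :: "nat \<Rightarrow> real" assume t: "mono_on {..n} t" "t ` {..n} \<subseteq> {0..1}"
  define s where "s = (\<lambda>k. 1 - t (n - k))"
  have s: "mono_on {..n} s" "s ` {..n} \<subseteq> {0..1}"
    using t unfolding s_def by (auto simp: mono_on_def image_subset_iff)
  have "(\<Sum>k<n. ennreal (dist (reversepath g (t k)) (reversepath g (t (Suc k)))))
     = (\<Sum>k<n. ennreal (dist (reversepath g (t (n - Suc k))) (reversepath g (t (Suc (n - Suc k))))))"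
    by (rule sum.nat_diff_reindex[symmetric])
  also have "\<dots> = (\<Sum>k<n. ennreal (dist (g (s k)) (g (s (Suc k)))))"
    by (intro sum.cong refl) (auto simp: reversepath_def s_def dist_commute Suc_diff_Suc)
  also have "\<dots> \<le> path_length g"
    by (intro polygon_le_path_length s)
  finally show "(\<Sum>k<n. ennreal (dist (reversepath g (t k)) (reversepath g (t (Suc k))))) \<le> path_length g" .
qed

text \<open>Upper bounds for a sum of two suprema may be tested on pairs of polygons.\<close>

lemma path_length_add_le:
  fixes g h :: "real \<Rightarrow> 'a::metric_space"
  assumes "\<And>n t m s. mono_on {..n} t \<Longrightarrow> t ` {..n} \<subseteq> {0..1} \<Longrightarrow>
     mono_on {..m} s \<Longrightarrow> s ` {..m} \<subseteq> {0..1} \<Longrightarrow>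
     (\<Sum>k<n. ennreal (dist (g (t k)) (g (t (Suc k))))) + (\<Sum>k<m. ennreal (dist (h (s k)) (h (s (Suc k))))) \<le> C"
  shows "path_length g + path_length h \<le> C"
proof -
  let ?P = "{(n, t :: nat \<Rightarrow> real). mono_on {..n} t \<and> t ` {..n} \<subseteq> {0..1}}"
  define poly where "poly = (\<lambda>(g :: real \<Rightarrow> 'a) (n, t :: nat \<Rightarrow> real).
    \<Sum>k<n. ennreal (dist (g (t k)) (g (t (Suc k)))))"
  have len: "path_length g = (SUP x\<in>?P. poly g x)" for g
    by (simp only: path_length_def poly_def)
  have ne: "?P \<noteq> {}" by (auto intro!: exI[of _ "\<lambda>_. 0"] simp: mono_on_def)
  have "path_length g + path_length h = (SUP x\<in>?P. SUP y\<in>?P. poly g x + poly h y)"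
    by (simp add: len[of g] len[of h] ne ennreal_SUP_add_left[OF ne, symmetric] ennreal_SUP_add_right[OF ne, symmetric]
          del: sum_ennreal)
  also have "\<dots> \<le> C"
    using assms by (auto simp: poly_def simp del: sum_ennreal intro!: SUP_least)
  finally show ?thesis .
qed

text \<open>Two polygons of the parts, one after the other, form a polygon of the whole curve. The concatenated
  parameter sequence keeps both inner endpoints, which adds one edge across the cut.\<close>

lemma path_length_subpath_add_le:
  assumes u: "0 \<le> u" "u \<le> 1"
  shows "path_length (subpath 0 u g) + path_length (subpath u 1 g) \<le> path_length g"
proof (rule path_length_add_le)
  fix n m :: nat and t s :: "nat \<Rightarrow> real"
  assume t: "mono_on {..n} t" "t ` {..n} \<subseteq> {0..1}"
    and s: "mono_on {..m} s" "s ` {..m} \<subseteq> {0..1}"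
  define r where "r = (\<lambda>k. if k \<le> n then u * t k else u + (1 - u) * s (k - Suc n))"
  have lo: "0 \<le> r k \<and> r k \<le> u" if "k \<le> n" for k
  proof -
    have "t k \<in> {0..1}" using t(2) that by auto
    then show ?thesis using that u by (simp add: r_def mult_left_le)
  qed
  have hi: "u \<le> r k \<and> r k \<le> 1" if "n < k" "k \<le> n + Suc m" for k
  proof -
    have "s (k - Suc n) \<in> {0..1}" using s(2) that by (auto simp: image_subset_iff)
    then show ?thesis using that u mult_left_le[of "s (k - Suc n)" "1 - u"] by (simp add: r_def)
  qed
  have "mono_on {..n + Suc m} r"
  proof (rule mono_onI)
    fix i j assume ij: "i \<in> {..n + Suc m}" "j \<in> {..n + Suc m}" "i \<le> j"
    consider "j \<le> n" | "i \<le> n" "n < j" | "n < i" by linarith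
    then show "r i \<le> r j"
    proof cases
      case 1 then show ?thesis using ij t(1) u by (auto simp: r_def mono_on_def intro!: mult_left_mono)
    next
      case 2 then show ?thesis using lo[of i] hi[of j] ij by auto
    next
      case 3
      then have "s (i - Suc n) \<le> s (j - Suc n)" 
        using ij s(1) diff_le_mono[of i j "Suc n"] by (intro mono_onD[OF s(1)]) auto
      then show ?thesis using 3 ij u by (auto simp: r_def intro!: mult_left_mono)
    qed
  qed
  moreover have "r ` {..n + Suc m} \<subseteq> {0..1}"
  proof
    fix y assume "y \<in> r ` {..n + Suc m}"
    then obtain k where "k \<le> n + Suc m" "y = r k" by auto
    then show "y \<in> {0..1}" using lo[of k] hi[of k] u by (cases "k \<le> n") auto
  qed
  ultimately have le: "(\<Sum>k<n + Suc m. ennreal (dist (g (r k)) (g (r (Suc k))))) \<le> path_length g"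
    by (rule polygon_le_path_length)
  have "(\<Sum>k<n. ennreal (dist (subpath 0 u g (t k)) (subpath 0 u g (t (Suc k))))) 
      = (\<Sum>k<n. ennreal (dist (g (r k)) (g (r (Suc k)))))"
    by (rule sum.cong) (auto simp: subpath_def r_def)
  moreover have "(\<Sum>k<m. ennreal (dist (subpath u 1 g (s k)) (subpath u 1 g (s (Suc k)))))
      = (\<Sum>k<m. ennreal (dist (g (r (k + Suc n))) (g (r (Suc (k + Suc n))))))"
    by (rule sum.cong) (auto simp: subpath_def r_def algebra_simps)
  moreover have "(\<Sum>k<n + Suc m. ennreal (dist (g (r k)) (g (r (Suc k)))))
      = (\<Sum>k<Suc n. ennreal (dist (g (r k)) (g (r (Suc k)))))
       + (\<Sum>k<m. ennreal (dist (g (r (k + Suc n))) (g (r (Suc (k + Suc n))))))"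
  proof -
    have "(\<Sum>k<N + m. f k) = (\<Sum>k<N. f k) + (\<Sum>k<m. f (k + N))" for N and f :: "nat \<Rightarrow> ennreal"
      by (induction m) (simp_all add: ac_simps)
    from this[where N = "Suc n"] show ?thesis by (simp only: add_Suc_shift)
  qed
  ultimately show "(\<Sum>k<n. ennreal (dist (subpath 0 u g (t k)) (subpath 0 u g (t (Suc k)))))
      + (\<Sum>k<m. ennreal (dist (subpath u 1 g (s k)) (subpath u 1 g (s (Suc k))))) \<le> path_length g"
    using le by (simp add: add_right_mono order_trans[rotated])
qed

section \<open>The path metric\<close>

context sierpinski
begin

abbreviation d :: "real^2 \<Rightarrow> real^2 \<Rightarrow> real" where "d \<equiv> path_dist q"

definition curves :: "real^2 \<Rightarrow> real^2 \<Rightarrow> (real \<Rightarrow> real^2) set" where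
  "curves x y = {\<gamma>. path \<gamma> \<and> path_image \<gamma> \<subseteq> gasket q \<and> pathstart \<gamma> = x \<and> pathfinish \<gamma> = y}"

lemma path_dist_eq: "d x y = enn2real (INF \<gamma>\<in>curves x y. path_length \<gamma>)"
  by (simp add: path_dist_def curves_def)

lemma lipschitz_linepath_vertices: "1-lipschitz_on A (linepath (q i) (q j))"
proof (rule lipschitz_onI)
  fix s t :: real
  have "linepath (q i) (q j) s - linepath (q i) (q j) t = (t - s) *\<^sub>R (q i - q j)"
    by (simp add: linepath_def algebra_simps)
  then have "dist (linepath (q i) (q j) s) (linepath (q i) (q j) t) = \<bar>t - s\<bar> * dist (q i) (q j)"
    by (simp add: dist_norm)
  then show "dist (linepath (q i) (q j) s) (linepath (q i) (q j) t) \<le> 1 * dist s t"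
    using dist_vertices[of i j] by (cases "i = j") (auto simp: dist_real_def)
qed simp

text \<open>A point of level \<open>n + 1\<close> lies in some \<open>psi q j\<close>-image. Half a side leads from \<open>q i\<close> to the corner
  \<open>psi q j (q i)\<close> of that image, and a copy of the curve for level \<open>n\<close>, shrunk by one half, leads on from
  there; each part has a parameter interval of length one half and speed at most \<open>1\<close>.\<close>

lemma curve_to_V:
  "p \<in> V q n \<Longrightarrow> \<exists>\<gamma>::real \<Rightarrow> real^2. 1-lipschitz_on {0..1} \<gamma> \<and> \<gamma> ` {0..1} \<subseteq> gasket q \<and> \<gamma> 0 = q i \<and> \<gamma> 1 = p"
proof (induction n arbitrary: p)
  case 0
  then obtain j where p: "p = q j" by (auto simp: V_0)
  show ?case
    using segment_subset_gasket[of q i j] lipschitz_linepath_vertices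
    by (intro exI[of _ "linepath (q i) (q j)"]) (auto simp: p linepath_0' linepath_1' linepath_image_01)
next
  case (Suc n)
  then obtain j p' where p: "p' \<in> V q n" "p = psi q j p'" by (auto simp: V_Suc)
  from Suc.IH[OF p(1)] obtain g :: "real \<Rightarrow> real^2" where g: "1-lipschitz_on {0..1} g" "g ` {0..1} \<subseteq> gasket q" "g 0 = q i" "g 1 = p'"
    by blast
  let ?l = "\<lambda>t. linepath (q i) (q j) t" and ?r = "\<lambda>t. psi q j (g (2 * t - 1))"
  have 1: "1-lipschitz_on {0..1/2} ?l" by (rule lipschitz_linepath_vertices)
  have 2: "1-lipschitz_on {1/2..1} ?r"
  proof (rule lipschitz_onI)
    fix s t :: real assume "s \<in> {1/2..1}" "t \<in> {1/2..1}"
    then have "dist (g (2 * s - 1)) (g (2 * t - 1)) \<le> 1 * dist (2 * s - 1) (2 * t - 1)"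
      by (intro lipschitz_onD[OF g(1)]) auto
    also have "dist (2 * s - 1) (2 * t - 1) = 2 * dist s t"
      by (auto simp: dist_real_def abs_if)
    finally show "dist (?r s) (?r t) \<le> 1 * dist s t"
      by (simp add: dist_psi)
  qed simp
  have "?l (1/2) = ?r (1/2)"
    by (simp add: g linepath_def psi_alt scaleR_add_right)
  with 1 2 have lip: "1-lipschitz_on {0..1} (\<lambda>t. if t \<le> 1/2 then ?l t else ?r t)"
    by (rule lipschitz_on_concat)
  have in_gasket: "(if t \<le> 1/2 then ?l t else ?r t) \<in> gasket q" if "t \<in> {0..1}" for t
  proof (cases "t \<le> 1/2")
    case True
    then show ?thesis using that segment_subset_gasket[of q i j] linepath_in_path[of t "q i" "q j"] by auto
  next
    case False
    then have "g (2 * t - 1) \<in> gasket q" using that g(2) by (auto simp: image_subset_iff)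
    then show ?thesis using False gasket_Union_psi[of q] by auto
  qed
  then have "(\<lambda>t. if t \<le> 1/2 then ?l t else ?r t) ` {0..1} \<subseteq> gasket q" by blast
  with lip show ?case
    by (intro exI[of _ "\<lambda>t. if t \<le> 1/2 then ?l t else ?r t"]) (simp add: linepath_0' g p)
qed

text \<open>The Lipschitz constant of \<open>curve_to_V\<close> does not depend on the level, so by the Arzela-Ascoli theorem
  the curves to vertices approximating \<open>p\<close> subconverge to a curve ending in \<open>p\<close>.\<close>

lemma curve_to_gasket:
  assumes "p \<in> gasket q"
  shows "\<exists>\<gamma>::real \<Rightarrow> real^2. 1-lipschitz_on {0..1} \<gamma> \<and> \<gamma> ` {0..1} \<subseteq> gasket q \<and> \<gamma> 0 = q i \<and> \<gamma> 1 = p"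
proof -
  obtain x where x: "\<And>k. x k \<in> (\<Union>n. V q n)" "x \<longlonglongrightarrow> p"
    using assms unfolding gasket_def closure_sequential by blast
  have "\<forall>k. \<exists>\<gamma>::real \<Rightarrow> real^2. 1-lipschitz_on {0..1} \<gamma> \<and> \<gamma> ` {0..1} \<subseteq> gasket q \<and> \<gamma> 0 = q i \<and> \<gamma> 1 = x k"
    using x(1) curve_to_V by blast
  then obtain F :: "nat \<Rightarrow> real \<Rightarrow> real^2" where F: "\<And>k. 1-lipschitz_on {0..1} (F k)" "\<And>k. F k ` {0..1} \<subseteq> gasket q"
    "\<And>k. F k 0 = q i" "\<And>k. F k 1 = x k"
    by metis
  obtain M where M: "\<And>y. y \<in> gasket q \<Longrightarrow> norm y \<le> M"
    using compact_imp_bounded[OF compact_gasket] unfolding bounded_iff by blast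
  obtain g k where g: "strict_mono (k :: nat \<Rightarrow> nat)"
    "\<And>e. 0 < e \<Longrightarrow> \<exists>N. \<forall>n t. n \<ge> N \<and> t \<in> {0..1} \<longrightarrow> norm (F (k n) t - g t) < e"
  proof (rule Arzela_Ascoli[of "{0..1::real}" F M])
    show "norm (F n t) \<le> M" if "t \<in> {0..1}" for n t
      using F(2) M that by blast
    show "\<exists>d>0. \<forall>n s. s \<in> {0..1} \<and> norm (t - s) < d \<longrightarrow> norm (F n t - F n s) < e"
      if "t \<in> {0..1}" "0 < e" for t e
    proof -
      have "norm (F n t - F n s) \<le> norm (t - s)" if "s \<in> {0..1}" for n s
        using lipschitz_onD[OF F(1) \<open>t \<in> {0..1}\<close> that, of n] by (simp add: dist_norm)
      then show ?thesis using \<open>0 < e\<close> by (meson order_le_less_trans)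
    qed
  qed auto
  have lim: "(\<lambda>n. F (k n) t) \<longlonglongrightarrow> g t" if "t \<in> {0..1}" for t
    unfolding LIMSEQ_iff using g(2) that by blast
  have "1-lipschitz_on {0..1} g"
  proof (rule lipschitz_onI)
    fix s t :: real assume st: "s \<in> {0..1}" "t \<in> {0..1}"
    have "(\<lambda>n. dist (F (k n) s) (F (k n) t)) \<longlonglongrightarrow> dist (g s) (g t)"
      using st by (intro tendsto_dist lim)
    then show "dist (g s) (g t) \<le> 1 * dist s t"
      by (rule LIMSEQ_le_const2) (use st lipschitz_onD[OF F(1)] in auto)
  qed simp
  moreover have "g t \<in> gasket q" if "t \<in> {0..1}" for t
    by (rule closed_sequentially[OF closed_gasket _ lim[OF that]]) (use F(2) that in blast)
  moreover have "g 0 = q i"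
    using lim[of 0] F(3) LIMSEQ_const_iff[of "q i" "g 0"] by simp
  moreover have "g 1 = p"
    using lim[of 1] F(4) LIMSEQ_subseq_LIMSEQ[OF x(2) g(1)] by (intro LIMSEQ_unique[of "x \<circ> k"]) (auto simp: o_def)
  ultimately show ?thesis by blast
qed

lemma curve_in_cell:
  assumes "a \<in> corners q w" "p \<in> cell q w"
  obtains \<gamma> where "path \<gamma>" "path_image \<gamma> \<subseteq> cell q w" "pathstart \<gamma> = a" "pathfinish \<gamma> = p"
    "path_length \<gamma> \<le> ennreal (1 / 2 ^ length w)"
proof -
  obtain i p' where p: "a = psi_word q w (q i)" "p = psi_word q w p'" "p' \<in> gasket q"
    using assms by (auto simp: corners_def cell_def)
  obtain g :: "real \<Rightarrow> real^2" where g: "1-lipschitz_on {0..1} g" "g ` {0..1} \<subseteq> gasket q" "g 0 = q i" "g 1 = p'"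
    using curve_to_gasket[OF p(3)] by blast
  have L: "(1 / 2 ^ length w)-lipschitz_on {0..1} (psi_word q w \<circ> g)"
    using lipschitz_onD[OF g(1)] by (intro lipschitz_onI) (auto simp: dist_psi_word divide_right_mono)
  then have "path (psi_word q w \<circ> g)"
    unfolding path_def by (rule lipschitz_on_continuous_on)
  moreover have "path_image (psi_word q w \<circ> g) \<subseteq> cell q w"
    using g(2) by (auto simp: path_image_def cell_def)
  ultimately show ?thesis
    using that[of "psi_word q w \<circ> g"] path_length_lipschitz[OF L] g p
    by (simp add: pathstart_def pathfinish_def)
qed

lemma path_dist_le:
  assumes "\<gamma> \<in> curves x y" "path_length \<gamma> \<le> ennreal L" "0 \<le> L"
  shows "d x y \<le> L"
  unfolding path_dist_eq using assms by (intro enn2real_leI INF_lower2[of \<gamma>])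

lemma curves_reversepath: "\<gamma> \<in> curves x y \<Longrightarrow> reversepath \<gamma> \<in> curves y x"
  by (simp add: curves_def path_image_reversepath)

lemma curves_join: "\<gamma> \<in> curves x y \<Longrightarrow> \<delta> \<in> curves y z \<Longrightarrow> \<gamma> +++ \<delta> \<in> curves x z"
  by (auto simp: curves_def path_image_join)

lemma INF_curves_finite:
  assumes "x \<in> gasket q" "y \<in> gasket q"
  shows "(INF \<gamma>\<in>curves x y. path_length \<gamma>) < top"
proof -
  have "\<exists>\<gamma>\<in>curves (q 1) z. path_length \<gamma> \<le> ennreal 1" if "z \<in> gasket q" for z
    using curve_in_cell[of "q 1" "[]" z] that by (auto simp: corners_def cell_def curves_def)
  then obtain \<gamma> \<delta> where g: "\<gamma> \<in> curves (q 1) x" "path_length \<gamma> \<le> ennreal 1"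
    and h: "\<delta> \<in> curves (q 1) y" "path_length \<delta> \<le> ennreal 1"
    using assms by blast
  have "path_length (reversepath \<gamma> +++ \<delta>) \<le> path_length (reversepath \<gamma>) + path_length \<delta>"
    using g h by (intro path_length_join) (simp add: curves_def)
  also have "\<dots> \<le> ennreal 1 + ennreal 1"
    by (intro add_mono h order_trans[OF path_length_reversepath g(2)])
  also have "\<dots> < top" by (simp flip: ennreal_plus)
  finally show ?thesis
    using curves_join[OF curves_reversepath[OF g(1)] h(1)] by (meson INF_lower order_le_less_trans)
qed

lemma ennreal_path_dist:
  "x \<in> gasket q \<Longrightarrow> y \<in> gasket q \<Longrightarrow> ennreal (d x y) = (INF \<gamma>\<in>curves x y. path_length \<gamma>)"
  unfolding path_dist_eq using INF_curves_finite by simp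

lemma path_dist_nonneg [simp]: "0 \<le> d x y"
  by (simp add: path_dist_def)

text \<open>Curves of almost minimal length take the place of geodesics.\<close>

lemma near_geodesic:
  assumes "x \<in> gasket q" "y \<in> gasket q" "0 < e"
  obtains \<gamma> where "\<gamma> \<in> curves x y" "path_length \<gamma> < ennreal (d x y + e)"
proof -
  have "(INF \<gamma>\<in>curves x y. path_length \<gamma>) < ennreal (d x y + e)"
    using assms by (simp flip: ennreal_path_dist add: ennreal_less_iff)
  then show ?thesis using that by (auto simp: INF_less_iff)
qed

lemma dist_le_path_dist:
  assumes "x \<in> gasket q" "y \<in> gasket q"
  shows "dist x y \<le> d x y"
proof -
  have "ennreal (dist x y) \<le> path_length \<gamma>" if "\<gamma> \<in> curves x y" for \<gamma>
    using dist_le_path_length[of 0 1 \<gamma>] that by (auto simp: curves_def pathstart_def pathfinish_def)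
  then have "ennreal (dist x y) \<le> ennreal (d x y)"
    unfolding ennreal_path_dist[OF assms] by (intro INF_greatest)
  then show ?thesis by simp
qed

lemma path_dist_self [simp]: 
  assumes "x \<in> gasket q" shows "d x x = 0"
proof -
  have "0-lipschitz_on {0..1::real} (\<lambda>_. x)" by (simp add: lipschitz_on_def)
  then have "path_length (\<lambda>_::real. x) \<le> ennreal 0" by (rule path_length_lipschitz)
  then have "d x x \<le> 0"
    using assms by (intro path_dist_le[of "\<lambda>_. x"]) (auto simp: curves_def path_def path_image_def pathstart_def pathfinish_def)
  then show ?thesis by (simp add: antisym)
qed

lemma path_dist_pos: "x \<in> gasket q \<Longrightarrow> y \<in> gasket q \<Longrightarrow> x \<noteq> y \<Longrightarrow> 0 < d x y"
  using dist_le_path_dist[of x y] by (smt (verit) zero_less_dist_iff)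

lemma path_dist_triangle:
  assumes "x \<in> gasket q" "y \<in> gasket q" "z \<in> gasket q"
  shows "d x z \<le> d x y + d y z"
proof (rule field_le_epsilon)
  fix e :: real assume "0 < e"
  then have e2: "0 < e/2" by simp
  obtain \<gamma> where g: "\<gamma> \<in> curves x y" "path_length \<gamma> < ennreal (d x y + e/2)"
    using near_geodesic[OF assms(1,2) e2] .
  obtain \<delta> where h: "\<delta> \<in> curves y z" "path_length \<delta> < ennreal (d y z + e/2)"
    using near_geodesic[OF assms(2,3) e2] .
  have "path_length (\<gamma> +++ \<delta>) \<le> path_length \<gamma> + path_length \<delta>"
    using g h by (intro path_length_join) (simp add: curves_def)
  also have "\<dots> \<le> ennreal (d x y + e/2) + ennreal (d y z + e/2)"
    by (intro add_mono less_imp_le g h)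
  also have "\<dots> = ennreal (d x y + d y z + e)"
    using \<open>0 < e\<close> by (simp add: algebra_simps flip: ennreal_plus)
  finally show "d x z \<le> d x y + d y z + e"
    using \<open>0 < e\<close> by (intro path_dist_le[OF curves_join[OF g(1) h(1)]]) auto
qed

lemma path_dist_commute:
  assumes "x \<in> gasket q" "y \<in> gasket q"
  shows "d x y = d y x"
proof -
  have "d x y \<le> d y x" if xy: "x \<in> gasket q" "y \<in> gasket q" for x y
  proof (rule field_le_epsilon)
    fix e :: real assume "0 < e"
    obtain \<gamma> where g: "\<gamma> \<in> curves y x" "path_length \<gamma> < ennreal (d y x + e)"
      using near_geodesic[OF xy(2,1) \<open>0 < e\<close>] .
    then show "d x y \<le> d y x + e"
      using \<open>0 < e\<close>
      by (intro path_dist_le[OF curves_reversepath[OF g(1)]] order_trans[OF path_length_reversepath]) auto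
  qed
  then show ?thesis using assms by (meson antisym)
qed

lemma path_dist_corner:
  assumes "a \<in> corners q w" "p \<in> cell q w"
  shows "d a p \<le> 1 / 2 ^ length w"
  using curve_in_cell[OF assms] cell_subset_gasket[of q w]
  by (smt (verit) path_dist_le curves_def mem_Collect_eq order_trans zero_le_divide_1_iff zero_le_power)

lemma path_dist_cell:
  assumes "x \<in> cell q w" "y \<in> cell q w"
  shows "d x y \<le> 2 / 2 ^ length w"
proof -
  have a: "psi_word q w (q 1) \<in> corners q w" by (simp add: corners_def)
  then have in_g: "psi_word q w (q 1) \<in> gasket q" "x \<in> gasket q" "y \<in> gasket q"
    using assms cell_subset_gasket corners_subset_cell by blast+
  have "d x y \<le> d (psi_word q w (q 1)) x + d (psi_word q w (q 1)) y"
    using path_dist_triangle[of x "psi_word q w (q 1)" y] path_dist_commute[of x "psi_word q w (q 1)"] in_g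
    by simp
  then show ?thesis using path_dist_corner[OF a assms(1)] path_dist_corner[OF a assms(2)] by simp
qed

text \<open>A nearly shortest curve from inside \<open>A\<close> to outside is connected and so meets the frontier; any
  of its points splits its length, which makes the triangle inequality nearly an equality there.\<close>

lemma exit_point:
  assumes "x \<in> A" "x \<in> gasket q" "y \<in> gasket q" "y \<notin> A" "0 < e"
  obtains z where "z \<in> gasket_top q frontier_of A" "d x z + d z y \<le> d x y + e"
proof -
  obtain \<gamma> where g: "\<gamma> \<in> curves x y" "path_length \<gamma> < ennreal (d x y + e)"
    using near_geodesic[OF assms(2,3,5)] .
  have p: "path \<gamma>" "path_image \<gamma> \<subseteq> gasket q" "pathstart \<gamma> = x" "pathfinish \<gamma> = y"
    using g(1) by (auto simp: curves_def)
  have "path_image \<gamma> \<inter> gasket_top q frontier_of A \<noteq> {}"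
  proof (rule connectedin_Int_frontier_of)
    show "connectedin (gasket_top q) (path_image \<gamma>)"
      using p connected_path_image by (simp add: connectedin_subtopology)
    show "path_image \<gamma> \<inter> A \<noteq> {}" "path_image \<gamma> - A \<noteq> {}"
      using p assms pathstart_in_path_image[of \<gamma>] pathfinish_in_path_image[of \<gamma>] by auto
  qed
  then obtain t where t: "0 \<le> t" "t \<le> 1" "\<gamma> t \<in> gasket_top q frontier_of A"
    by (auto simp: path_image_def)
  then have z: "\<gamma> t \<in> gasket q" using p by (auto simp: path_image_def)
  have "subpath 0 t \<gamma> \<in> curves x (\<gamma> t)"
    using p t path_image_subpath_subset[of 0 t \<gamma>] 
    by (auto simp: curves_def path_subpath) (simp add: pathstart_def)
  moreover have "subpath t 1 \<gamma> \<in> curves (\<gamma> t) y"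
    using p t path_image_subpath_subset[of t 1 \<gamma>] 
    by (auto simp: curves_def path_subpath) (simp add: pathfinish_def)
  ultimately have "ennreal (d x (\<gamma> t)) + ennreal (d (\<gamma> t) y) \<le> path_length (subpath 0 t \<gamma>) + path_length (subpath t 1 \<gamma>)"
    using assms z by (simp add: ennreal_path_dist add_mono INF_lower)
  also have "\<dots> \<le> path_length \<gamma>" using t by (intro path_length_subpath_add_le)
  also note g(2)
  finally have "d x (\<gamma> t) + d (\<gamma> t) y \<le> d x y + e"
    using assms(5) by (simp add: ennreal_less_iff flip: ennreal_plus)
  then show ?thesis using that t by blast
qed

section \<open>Topology of the gasket\<close>

text \<open>The finitely many cells of level \<open>n\<close> that miss \<open>x\<close> are closed.\<close>

lemma cell_neighbourhood:
  assumes "x \<in> gasket q"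
  obtains U where "openin (gasket_top q) U" "x \<in> U"
    "\<And>y. y \<in> U \<Longrightarrow> \<exists>w. length w = n \<and> x \<in> cell q w \<and> y \<in> cell q w"
proof
  let ?F = "\<Union>w\<in>{w. length w = n \<and> x \<notin> cell q w}. cell q w"
  have "closed ?F"
    by (intro closed_UN finite_subset[OF _ finite_words[of n]] ballI closed_cell) auto
  then show "openin (gasket_top q) (gasket q - ?F)"
    unfolding Diff_eq by (intro openin_open_Int open_Compl)
  show "x \<in> gasket q - ?F" using assms by auto
  show "\<exists>w. length w = n \<and> x \<in> cell q w \<and> y \<in> cell q w" if "y \<in> gasket q - ?F" for y
    using that gasket_eq_Union_cells[of q n] by blast
qed

lemma continuous_on_gasketI:
  fixes f :: "real^2 \<Rightarrow> real"
  assumes "\<And>n x y w. length w = n \<Longrightarrow> x \<in> cell q w \<Longrightarrow> y \<in> cell q w \<Longrightarrow> \<bar>f x - f y\<bar> \<le> C / 2 ^ n"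
  shows "continuous_on (gasket q) f"
  unfolding continuous_on_iff
proof (intro ballI allI impI)
  fix x and e :: real assume x: "x \<in> gasket q" "0 < e"
  obtain n where n: "C / 2 ^ n < e" using small_power[OF x(2)] .
  obtain U where U: "openin (gasket_top q) U" "x \<in> U"
    "\<And>y. y \<in> U \<Longrightarrow> \<exists>w. length w = n \<and> x \<in> cell q w \<and> y \<in> cell q w"
    using cell_neighbourhood[OF x(1)] by blast
  then obtain r where "r > 0" "\<forall>y\<in>gasket q. dist y x < r \<longrightarrow> y \<in> U"
    unfolding openin_euclidean_subtopology_iff by blast
  moreover have "dist (f y) (f x) < e" if "y \<in> U" for y
    using U(3)[OF that] assms[of _ n y x] n by (fastforce simp: dist_real_def)
  ultimately show "\<exists>r>0. \<forall>y\<in>gasket q. dist y x < r \<longrightarrow> dist (f y) (f x) < e" by blast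
qed

lemma continuous_on_path_dist:
  assumes "x0 \<in> gasket q"
  shows "continuous_on (gasket q) (d x0)"
proof (rule continuous_on_gasketI)
  fix n x y and w :: "3 list" assume w: "length w = n" "x \<in> cell q w" "y \<in> cell q w"
  then have g: "x \<in> gasket q" "y \<in> gasket q" using cell_subset_gasket by blast+
  show "\<bar>d x0 x - d x0 y\<bar> \<le> 2 / 2 ^ n"
    using path_dist_triangle[OF assms g] path_dist_triangle[OF assms g(2,1)] path_dist_commute[OF g]
      path_dist_cell[OF w(2,3)] w(1)
    by simp
qed

lemma connected_cell: "connected (cell q w)"
proof -
  have "path_component (cell q w) (psi_word q w (q 1)) p" if "p \<in> cell q w" for p
    using curve_in_cell[OF _ that, of "psi_word q w (q 1)"]
    by (auto simp: path_component_def corners_def)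
  then have "path_connected (cell q w)"
    unfolding path_connected_component by (meson path_component_sym path_component_trans)
  then show ?thesis by (rule path_connected_imp_connected)
qed

text \<open>The cells containing a point are connected, arbitrarily small, and together form a neighbourhood.\<close>

lemma locally_connected_gasket: "locally connected (gasket q)"
  unfolding locally_connected_im_kleinen
proof (intro allI impI)
  fix v x assume v: "openin (gasket_top q) v \<and> x \<in> v"
  then have x: "x \<in> gasket q" using openin_imp_subset by blast
  obtain r where r: "r > 0" "\<And>y. y \<in> gasket q \<Longrightarrow> dist y x < r \<Longrightarrow> y \<in> v"
    using v unfolding openin_euclidean_subtopology_iff by blast
  obtain n where n: "2 / 2 ^ n < r" using small_power[OF r(1)] .
  obtain U where U: "openin (gasket_top q) U" "x \<in> U"
    "\<And>y. y \<in> U \<Longrightarrow> \<exists>w. length w = n \<and> x \<in> cell q w \<and> y \<in> cell q w"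
    using cell_neighbourhood[OF x] by blast
  have sub: "cell q w \<subseteq> v" if "length w = n" "x \<in> cell q w" for w
  proof
    fix y assume y: "y \<in> cell q w"
    then have "y \<in> gasket q" using cell_subset_gasket by blast
    moreover have "dist y x < r"
      using path_dist_cell[OF y that(2)] dist_le_path_dist[OF \<open>y \<in> gasket q\<close> x] n that(1) by simp
    ultimately show "y \<in> v" using r(2) by blast
  qed
  show "\<exists>u. openin (gasket_top q) u \<and> x \<in> u \<and> u \<subseteq> v \<and>
            (\<forall>y. y \<in> u \<longrightarrow> (\<exists>c. connected c \<and> c \<subseteq> v \<and> x \<in> c \<and> y \<in> c))"
    using U sub connected_cell by (intro exI[of _ U]) blast
qed

lemma frontier_of_openin: "openin X A \<Longrightarrow> X frontier_of A = X closure_of A - A"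
  by (simp add: frontier_of_def interior_of_openin)

text \<open>By local connectedness the components of \<open>A\<close> are open, so none of them contains a closure point of
  another.\<close>

lemma frontier_of_component:
  assumes A: "openin (gasket_top q) A" and C: "C \<in> components A"
  shows "gasket_top q frontier_of C \<subseteq> gasket_top q frontier_of A"
proof
  have op: "openin (gasket_top q) D" if "D \<in> components A" for D
    using locally_connected_gasket A that unfolding locally_connected_open_component by blast
  fix p assume "p \<in> gasket_top q frontier_of C"
  then have p: "p \<in> gasket_top q closure_of C" "p \<notin> C"
    by (auto simp: frontier_of_openin[OF op[OF C]])
  have "p \<notin> A"
  proof
    assume "p \<in> A"
    then obtain D where D: "D \<in> components A" "p \<in> D" using Union_components[of A] by blast
    then have "D \<inter> C \<noteq> {}" using p op[OF D(1)] unfolding in_closure_of by blast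
    then show False using components_eq[OF D(1) C] D p by blast
  qed
  then show "p \<in> gasket_top q frontier_of A"
    using p closure_of_mono[OF in_components_subset[OF C], of "gasket_top q"]
    by (auto simp: frontier_of_openin[OF A])
qed

end

section \<open>Comparison and existence on finite graphs\<close>

lemma Max_Min_image_attained:
  assumes "finite N" "N \<noteq> {}"
  obtains y z where "y \<in> N" "Max (f ` N) = f y" "z \<in> N" "Min (f ` N) = f z"
proof -
  have "Max (f ` N) \<in> f ` N" "Min (f ` N) \<in> f ` N" using assms by (intro Max_in Min_in; simp)+
  then show ?thesis using that by blast
qed

lemma Max_image_mono:
  fixes f g :: "'a \<Rightarrow> real"
  assumes "finite N" "N \<noteq> {}" "\<And>y. y \<in> N \<Longrightarrow> f y \<le> g y"
  shows "Max (f ` N) \<le> Max (g ` N)"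
  using assms by (force intro!: Max.boundedI intro: order_trans[OF _ Max_ge])

lemma Min_image_mono:
  fixes f g :: "'a \<Rightarrow> real"
  assumes "finite N" "N \<noteq> {}" "\<And>y. y \<in> N \<Longrightarrow> f y \<le> g y"
  shows "Min (f ` N) \<le> Min (g ` N)"
  using assms by (force intro!: Min.boundedI intro: order_trans[OF Min_le])

lemma Max_image_uminus:
  fixes f :: "'a \<Rightarrow> real"
  assumes "finite N" "N \<noteq> {}"
  shows "Max ((\<lambda>y. - f y) ` N) = - Min (f ` N)"
proof (rule Max_eqI)
  have "Min (f ` N) \<in> f ` N" using assms by (intro Min_in) auto
  then show "- Min (f ` N) \<in> (\<lambda>y. - f y) ` N" by auto
qed (use assms in auto)

lemma Min_image_uminus:
  fixes f :: "'a \<Rightarrow> real"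
  assumes "finite N" "N \<noteq> {}"
  shows "Min ((\<lambda>y. - f y) ` N) = - Max (f ` N)"
  using Max_image_uminus[OF assms, of "\<lambda>y. - f y"] by simp

text \<open>Suppose \<open>U - W\<close> has a positive maximum over \<open>D\<close>, and among the points attaining it take those where
  \<open>U\<close> is largest. At such a point the two inequalities become equalities; a neighbour with
  the largest value of \<open>U\<close> again attains the maximum of \<open>U - W\<close>, so \<open>U\<close> does not increase, and then
  \<open>U\<close> and \<open>W\<close> are constant on all neighbours. Moving to a neighbour of smaller rank stays in the same
  set, which is impossible forever. The rank replaces connectedness of the graph to its boundary.\<close>

lemma graph_comparison:
  fixes N :: "'a \<Rightarrow> 'a set" and U W :: "'a \<Rightarrow> real" and r :: "'a \<Rightarrow> real"
  assumes D: "finite D" and N: "\<And>x. x \<in> D \<Longrightarrow> finite (N x)"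
    and sub: "\<And>x. x \<in> D \<Longrightarrow> 2 * U x \<le> Max (U ` N x) + Min (U ` N x)"
    and super: "\<And>x. x \<in> D \<Longrightarrow> Max (W ` N x) + Min (W ` N x) \<le> 2 * W x"
    and boundary: "\<And>x y. x \<in> D \<Longrightarrow> y \<in> N x \<Longrightarrow> y \<notin> D \<Longrightarrow> U y \<le> W y"
    and rank: "\<And>x. x \<in> D \<Longrightarrow> \<exists>y\<in>N x. r y < r x"
    and "x \<in> D"
  shows "U x \<le> W x"
proof (rule ccontr)
  assume "\<not> U x \<le> W x"
  define M where "M = Max ((\<lambda>x. U x - W x) ` D)"
  define E where "E = {x\<in>D. U x - W x = M}"
  have le_M: "U y - W y \<le> M" if "y \<in> D" for y
    unfolding M_def using D that by (intro Max_ge) auto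
  have "M > 0" using le_M[OF \<open>x \<in> D\<close>] \<open>\<not> U x \<le> W x\<close> by linarith
  have "M \<in> (\<lambda>x. U x - W x) ` D" unfolding M_def using D \<open>x \<in> D\<close> by (intro Max_in) auto
  then have E: "finite E" "E \<noteq> {}" using D by (auto simp: E_def)
  define F where "F = {x\<in>E. U x = Max (U ` E)}"
  have le_F: "U y \<le> Max (U ` E)" if "y \<in> E" for y
    using E that by (intro Max_ge) auto
  have "Max (U ` E) \<in> U ` E" using E by (intro Max_in) auto
  then obtain e where "e \<in> E" "U e = Max (U ` E)" by force
  then have F: "finite F" "F \<noteq> {}" using E by (auto simp: F_def)
  then obtain z where z: "z \<in> F" "\<And>y. y \<in> F \<Longrightarrow> r z \<le> r y"
    using arg_min_if_finite[OF F, of r] by (metis not_le_imp_less)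
  have zE: "z \<in> E" "z \<in> D" "U z - W z = M" using z(1) by (auto simp: F_def E_def)
  have fin: "finite (N z)" "N z \<noteq> {}" using N rank zE(2) by blast+
  have diff: "U y - W y \<le> M" if "y \<in> N z" for y
    using le_M[of y] boundary[OF zE(2) that] \<open>M > 0\<close> by (cases "y \<in> D") auto
  obtain y where y: "y \<in> N z" "Max (U ` N z) = U y"
    using Max_Min_image_attained[OF fin, of U] by blast
  have bounds: "Max (W ` N z) \<ge> W y'" "Min (W ` N z) \<le> W y'" "Max (U ` N z) \<ge> U y'" "Min (U ` N z) \<le> U y'" 
    if "y' \<in> N z" for y' using that fin by auto
  obtain v where v: "v \<in> N z" "Min (W ` N z) = W v"
    using Max_Min_image_attained[OF fin, of W] by blast
  \<comment> \<open>At a maximum of \<open>U - W\<close> all increments of \<open>U\<close> are dominated by those of \<open>W\<close>, so the two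
    inequalities can only hold with equality.\<close>
  have "Min (U ` N z) - U z \<le> Min (W ` N z) - W z"
    using bounds(4)[OF v(1)] diff[OF v(1)] v zE by linarith
  moreover have "Max (U ` N z) - U z \<le> Max (W ` N z) - W z"
    using bounds(1)[OF y(1)] diff[OF y(1)] y zE by linarith
  ultimately have eq: "Max (U ` N z) - U z = Max (W ` N z) - W z" "Min (U ` N z) - U z = Min (W ` N z) - W z"
    "Max (U ` N z) + Min (U ` N z) = 2 * U z"
    using sub[OF zE(2)] super[OF zE(2)] by linarith+
  have in_E: "y' \<in> E" if "y' \<in> N z" "U y' - W y' \<ge> M" for y'
    using diff[OF that(1)] that boundary[OF zE(2) that(1)] \<open>M > 0\<close> by (cases "y' \<in> D") (auto simp: E_def)
  have "y \<in> E" using bounds(1)[OF y(1)] eq(1) y zE by (intro in_E) auto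
  then have "Max (U ` N z) \<le> U z" using le_F y z(1) by (auto simp: F_def)
  then have const: "Max (U ` N z) = U z" "Min (U ` N z) = U z"
    using eq(3) bounds[OF y(1)] by linarith+
  obtain y' where y': "y' \<in> N z" "r y' < r z" using rank[OF zE(2)] by blast
  have "U y' = U z" "W y' = W z"
    using bounds[OF y'(1)] const eq by linarith+
  then have "y' \<in> F" using in_E[OF y'(1)] zE z(1) by (auto simp: F_def)
  then show False using z(2) y'(2) by fastforce
qed

text \<open>Perron's method: the operator \<open>T\<close> that averages the largest and the smallest neighbouring value is
  monotone, and the supremum of the bounded functions below their image under \<open>T\<close> is a fixed point.\<close>

lemma graph_harmonic_exists:
  fixes N :: "'a \<Rightarrow> 'a set" and b :: "'a \<Rightarrow> real"
  assumes N: "\<And>x. x \<in> D \<Longrightarrow> finite (N x) \<and> N x \<noteq> {}"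
    and b: "\<And>x. x \<notin> D \<Longrightarrow> \<bar>b x\<bar> \<le> M" and M: "0 \<le> M"
  obtains f where "\<And>x. x \<in> D \<Longrightarrow> Max (f ` N x) + Min (f ` N x) = 2 * f x" "\<And>x. x \<notin> D \<Longrightarrow> f x = b x"
proof -
  \<comment> \<open>The boundary values are part of \<open>T\<close>, so that a fixed point attains them.\<close>
  define T where "T = (\<lambda>f x. if x \<in> D then (Max (f ` N x) + Min (f ` N x)) / 2 else b x)"
  have T_mono: "T f x \<le> T g x" if "\<And>y. f y \<le> g y" for f g x
    using N[of x] that Max_image_mono[of "N x" f g] Min_image_mono[of "N x" f g] by (auto simp: T_def add_mono)
  have T_const: "T (\<lambda>_. M) x \<le> M" "- M \<le> T (\<lambda>_. - M) x" for x
    using N[of x] b[of x] by (auto simp: T_def image_constant_conv)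
  define G where "G = {g. (\<forall>x. g x \<le> T g x) \<and> (\<forall>x. g x \<le> M)}"
  define f where "f x = (SUP g\<in>G. g x)" for x
  have ne: "(\<lambda>_. - M) \<in> G" using T_const M by (auto simp: G_def)
  have bdd: "bdd_above ((\<lambda>g. g x) ` G)" for x
    by (rule bdd_aboveI[of _ M]) (auto simp: G_def)
  have upper: "g x \<le> f x" if "g \<in> G" for g x
    unfolding f_def using bdd that by (intro cSUP_upper) auto
  have least: "f x \<le> c" if "\<And>g. g \<in> G \<Longrightarrow> g x \<le> c" for x c
    unfolding f_def using ne that by (intro cSUP_least) auto
  have 1: "f x \<le> T f x" for x
  proof (rule least)
    fix g assume g: "g \<in> G"
    then have "g x \<le> T g x" by (auto simp: G_def)
    also have "\<dots> \<le> T f x" using upper[OF g] by (rule T_mono)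
    finally show "g x \<le> T f x" .
  qed
  have fM: "f x \<le> M" for x by (rule least) (auto simp: G_def)
  have "T f x \<le> M" for x
    by (rule order_trans[OF T_mono T_const(1)]) (rule fM)
  moreover have "T f x \<le> T (T f) x" for x by (rule T_mono) (rule 1)
  ultimately have "T f \<in> G" by (auto simp: G_def)
  then have T_le: "T f x \<le> f x" for x by (rule upper)
  have fixed: "f x = T f x" for x by (rule antisym[OF 1 T_le])
  show ?thesis
  proof (rule that[of f])
    show "Max (f ` N x) + Min (f ` N x) = 2 * f x" if "x \<in> D" for x
      using fixed[of x] that unfolding T_def by simp
    show "f x = b x" if "x \<notin> D" for x
      using fixed[of x] that unfolding T_def by simp
  qed
qed

section \<open>The graph of level \<open>n\<close>\<close>

context sierpinski
begin

abbreviation nb :: "nat \<Rightarrow> real^2 \<Rightarrow> (real^2) set" where "nb n x \<equiv> {y. adj q n x y}"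

lemma adj_iff:
  "adj q n x y \<longleftrightarrow> x \<noteq> y \<and> (\<exists>w. length w = n \<and> x \<in> corners q w \<and> y \<in> corners q w)"
proof
  assume "adj q n x y"
  then obtain w i j where w: "length w = n" "i \<noteq> j" "closed_segment x y = psi_word q w ` closed_segment (q i) (q j)"
    by (auto simp: adj_def)
  then have "{x, y} = {psi_word q w (q i), psi_word q w (q j)}"
    by (simp only: psi_word_image_closed_segment closed_segment_eq)
  moreover have "psi_word q w (q i) \<noteq> psi_word q w (q j)" using w by (simp add: inj_psi_word)
  ultimately have "x \<noteq> y" "x \<in> corners q w" "y \<in> corners q w"
    by (auto simp: doubleton_eq_iff corners_def)
  then show "x \<noteq> y \<and> (\<exists>w. length w = n \<and> x \<in> corners q w \<and> y \<in> corners q w)" using w by blast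
next
  assume "x \<noteq> y \<and> (\<exists>w. length w = n \<and> x \<in> corners q w \<and> y \<in> corners q w)"
  then obtain w i j where w: "x \<noteq> y" "length w = n" "x = psi_word q w (q i)" "y = psi_word q w (q j)"
    by (auto simp: corners_def)
  then have "i \<noteq> j" "closed_segment x y = psi_word q w ` closed_segment (q i) (q j)"
    by (auto simp: psi_word_image_closed_segment)
  moreover have "x \<in> V q n" "y \<in> V q n"
    using w corners_subset_V[of q w] by (auto simp: corners_def)
  ultimately show "adj q n x y" using w(2) unfolding adj_def by blast
qed

lemma adj_commute: "adj q n x y \<longleftrightarrow> adj q n y x"
  by (auto simp: adj_iff)

lemma adj_V: assumes "adj q n x y" shows "x \<in> V q n" "y \<in> V q n"
  using assms by (auto simp: adj_def)

lemma adj_gasket: assumes "adj q n x y" shows "x \<in> gasket q" "y \<in> gasket q"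
  using adj_V[OF assms] V_subset_gasket by blast+

lemma adj_dist: assumes "adj q n x y" shows "dist x y = 1 / 2 ^ n"
proof -
  obtain w i j where "x \<noteq> y" "length w = n" "x = psi_word q w (q i)" "y = psi_word q w (q j)"
    using assms by (auto simp: adj_iff corners_def)
  then show ?thesis using dist_vertices[of i j] by (auto simp: dist_psi_word)
qed

lemma adj_path_dist: assumes "adj q n x y" shows "d x y \<le> 1 / 2 ^ n"
  using assms path_dist_corner corners_subset_cell unfolding adj_iff by blast

lemma finite_nb: "finite (nb n x)"
  by (rule finite_subset[OF _ finite_V[of q n]]) (auto dest: adj_V)

lemma nb_nonempty: assumes "x \<in> V q n" shows "nb n x \<noteq> {}"
proof -
  obtain w i where w: "length w = n" "x = psi_word q w (q i)"
    using assms by (auto simp: V_eq_Union_corners corners_def)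
  obtain j :: 3 where "j \<noteq> i" using exhaust_3[of i] by (metis zero_neq_one zero_neq_numeral)
  then have "adj q n x (psi_word q w (q j))"
    unfolding adj_iff using w by (auto simp: inj_psi_word corners_def)
  then show ?thesis by blast
qed

text \<open>The open star of a vertex: the cells at \<open>x\<close> without their other corners.\<close>

definition star :: "nat \<Rightarrow> real^2 \<Rightarrow> (real^2) set" where
  "star n x = (\<Union>w\<in>{w. length w = n \<and> x \<in> cell q w}. cell q w) - (V q n - {x})"

lemma star_subset: "star n x \<subseteq> gasket q"
  unfolding star_def using cell_subset_gasket by blast

lemma star_Int_V: "y \<in> star n x \<Longrightarrow> y \<in> V q n \<Longrightarrow> y = x"
  by (auto simp: star_def)

lemma in_star: "x \<in> gasket q \<Longrightarrow> x \<in> star n x"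
  unfolding star_def using gasket_eq_Union_cells[of q n] by blast

text \<open>The complement of the star consists of the cells that miss \<open>x\<close> and of finitely many vertices,
  because a point in a cell at \<open>x\<close> and in a cell that misses \<open>x\<close> is a corner.\<close>

lemma openin_star: "openin (gasket_top q) (star n x)"
proof -
  let ?F = "(\<Union>w\<in>{w. length w = n \<and> x \<notin> cell q w}. cell q w) \<union> (V q n - {x})"
  have "closed ?F"
    by (intro closed_Un closed_UN finite_subset[OF _ finite_words[of n]] ballI closed_cell
        finite_imp_closed finite_subset[OF Diff_subset finite_V]) auto
  then have "openin (gasket_top q) (gasket q - ?F)"
    unfolding Diff_eq[of "gasket q"] by (intro openin_open_Int open_Compl)
  moreover have "gasket q - ?F = star n x"
  proof (intro equalityI subsetI)
    fix p assume p: "p \<in> gasket q - ?F"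
    then show "p \<in> star n x"
      unfolding star_def using gasket_eq_Union_cells[of q n] by blast
  next
    fix p assume p: "p \<in> star n x"
    then obtain w where w: "length w = n" "x \<in> cell q w" "p \<in> cell q w" "p \<notin> V q n - {x}"
      by (auto simp: star_def)
    have False if v: "length v = n" "x \<notin> cell q v" "p \<in> cell q v" for v
    proof -
      have "p \<in> corners q w" using cells_overlap[of w v p] v w by auto
      then have "p \<in> V q n" using corners_subset_V[of q w] w(1) by blast
      then show False using w v by auto
    qed
    then show "p \<in> gasket q - ?F" using w p star_subset by blast
  qed
  ultimately show ?thesis by simp
qed

lemma frontier_of_star:
  assumes "x \<in> V q n"
  shows "gasket_top q frontier_of (star n x) \<subseteq> nb n x"
proof
  fix p assume "p \<in> gasket_top q frontier_of (star n x)"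
  then have p: "p \<in> gasket_top q closure_of (star n x)" "p \<notin> star n x"
    by (auto simp: frontier_of_openin[OF openin_star])
  let ?K = "\<Union>w\<in>{w. length w = n \<and> x \<in> cell q w}. cell q w"
  have "closed ?K"
    by (intro closed_UN finite_subset[OF _ finite_words[of n]] ballI closed_cell) auto
  then have "closedin (gasket_top q) ?K"
    using cell_subset_gasket by (intro closed_subset) auto
  then have "gasket_top q closure_of (star n x) \<subseteq> ?K"
    by (intro closure_of_minimal) (auto simp: star_def)
  then obtain w where w: "length w = n" "x \<in> cell q w" "p \<in> cell q w" "p \<in> V q n" "p \<noteq> x"
    using p by (auto simp: star_def)
  then show "p \<in> nb n x" using V_Int_cell assms by (auto simp: adj_iff)
qed

text \<open>A nearly shortest curve to another vertex leaves the star through a neighbour, whose distance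
  from \<open>x\<close> is at least the Euclidean edge length. As there are finitely many neighbours, the one closest
  to \<open>x0\<close> works for every error.\<close>

lemma nearer_neighbour:
  assumes "x0 \<in> V q n" "x \<in> V q n" "x \<noteq> x0"
  shows "\<exists>y. adj q n x y \<and> d x0 y + 1 / 2 ^ n \<le> d x0 x"
proof -
  have g: "x0 \<in> gasket q" "x \<in> gasket q" using assms V_subset_gasket by blast+
  obtain y where y: "y \<in> nb n x" "\<And>z. z \<in> nb n x \<Longrightarrow> d y x0 \<le> d z x0"
    using arg_min_if_finite[OF finite_nb nb_nonempty[OF assms(2)], of "\<lambda>z. d z x0"]
    by (metis not_le_imp_less)
  have "d y x0 + 1 / 2 ^ n \<le> d x x0"
  proof (rule field_le_epsilon)
    fix e :: real assume "0 < e"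
    have "x0 \<notin> star n x" using star_Int_V assms by blast
    then obtain z where z: "z \<in> gasket_top q frontier_of (star n x)" "d x z + d z x0 \<le> d x x0 + e"
      using exit_point[OF in_star[OF g(2)] g(2,1) _ \<open>0 < e\<close>] by blast
    then have "z \<in> nb n x" using frontier_of_star[OF assms(2)] by blast
    then have "1 / 2 ^ n \<le> d x z" "d y x0 \<le> d z x0"
      using adj_dist[of n x z] dist_le_path_dist[of x z] adj_gasket[of n x z] y by auto
    then show "d y x0 + 1 / 2 ^ n \<le> d x x0 + e" using z(2) by linarith
  qed
  then show ?thesis using y(1) path_dist_commute g adj_gasket(2)[of n x y] by auto
qed

lemma graph_infinity_harmonic_iff:
  "graph_infinity_harmonic q n f \<longleftrightarrow>
    (\<forall>x\<in>V q n - V q 0. Max (f ` nb n x) + Min (f ` nb n x) = 2 * f x)"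
proof -
  have "(MAX y\<in>nb n x. f y - f x) = Max (f ` nb n x) - f x"
       "(MIN y\<in>nb n x. f y - f x) = Min (f ` nb n x) - f x" if "x \<in> V q n" for x
    using Max_add_commute[OF finite_nb nb_nonempty[OF that], of f "- f x"]
      Min_add_commute[OF finite_nb nb_nonempty[OF that], of f "- f x"] by simp_all
  then show ?thesis by (auto simp: graph_infinity_harmonic_def)
qed

lemma graph_infinity_harmonic_uminus:
  "graph_infinity_harmonic q n f \<Longrightarrow> graph_infinity_harmonic q n (\<lambda>x. - f x)"
  unfolding graph_infinity_harmonic_iff
proof
  fix x assume x: "x \<in> V q n - V q 0"
    and f: "\<forall>x\<in>V q n - V q 0. Max (f ` nb n x) + Min (f ` nb n x) = 2 * f x"
  have ne: "nb n x \<noteq> {}" using x nb_nonempty by blast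
  show "Max ((\<lambda>x. - f x) ` nb n x) + Min ((\<lambda>x. - f x) ` nb n x) = 2 * - f x"
    unfolding Max_image_uminus[OF finite_nb ne] Min_image_uminus[OF finite_nb ne]
    using bspec[OF f x] by linarith
qed

lemma graph_harmonic_extension:
  obtains f where "graph_infinity_harmonic q n f" "\<And>x. x \<in> V q 0 \<Longrightarrow> f x = u x"
proof -
  define b where "b x = (if x \<in> V q 0 then u x else 0)" for x
  define M where "M = (\<Sum>x\<in>V q 0. \<bar>u x\<bar>)"
  have "\<bar>b x\<bar> \<le> M" for x
    unfolding b_def M_def using member_le_sum[of x "V q 0" "\<lambda>x. \<bar>u x\<bar>"] finite_V[of q 0]
    by (auto intro: sum_nonneg)
  moreover have "0 \<le> M" by (auto simp: M_def intro: sum_nonneg)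
  ultimately obtain f where "\<And>x. x \<in> V q n - V q 0 \<Longrightarrow> Max (f ` nb n x) + Min (f ` nb n x) = 2 * f x"
    "\<And>x. x \<notin> V q n - V q 0 \<Longrightarrow> f x = b x"
    using graph_harmonic_exists[of "V q n - V q 0" "nb n" b M] finite_nb nb_nonempty by blast
  then show ?thesis using that[of f] by (auto simp: graph_infinity_harmonic_iff b_def)
qed

text \<open>The distance to \<open>x0\<close> grows by at most one edge length at any neighbour of \<open>x\<close> and drops by at least
  one at some neighbour.\<close>

lemma cone_supersolution:
  assumes "x0 \<in> V q n" "x \<in> V q n" "x \<noteq> x0" "0 \<le> l"
  shows "Max ((\<lambda>y. l * d x0 y + a) ` nb n x) + Min ((\<lambda>y. l * d x0 y + a) ` nb n x) \<le> 2 * (l * d x0 x + a)"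
proof -
  have g: "x0 \<in> gasket q" "x \<in> gasket q" using assms V_subset_gasket by blast+
  have "Max ((\<lambda>y. l * d x0 y + a) ` nb n x) \<le> l * (d x0 x + 1 / 2 ^ n) + a"
  proof (rule Max.boundedI)
    fix c assume "c \<in> (\<lambda>y. l * d x0 y + a) ` nb n x"
    then obtain y where y: "adj q n x y" "c = l * d x0 y + a" by auto
    have "d x0 y \<le> d x0 x + 1 / 2 ^ n"
      using path_dist_triangle[OF g adj_gasket(2)[OF y(1)]] adj_path_dist[OF y(1)] by linarith
    then show "c \<le> l * (d x0 x + 1 / 2 ^ n) + a" using y(2) assms(4) by (simp add: mult_left_mono)
  qed (use finite_nb nb_nonempty[OF assms(2)] in auto)
  moreover obtain y where y: "adj q n x y" "d x0 y + 1 / 2 ^ n \<le> d x0 x"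
    using nearer_neighbour[OF assms(1-3)] by blast
  have "Min ((\<lambda>y. l * d x0 y + a) ` nb n x) \<le> l * d x0 y + a"
    using y(1) finite_nb by (intro Min_le) auto
  moreover have "l * (d x0 y + 1 / 2 ^ n) \<le> l * d x0 x"
    using y(2) assms(4) by (rule mult_left_mono)
  ultimately show ?thesis by (simp add: algebra_simps)
qed

text \<open>As rank serves the distance to a vertex of level \<open>0\<close>: such a vertex lies outside \<open>D\<close>, so
  \<open>nearer_neighbour\<close> applies at every point of \<open>D\<close>.\<close>

lemma V_comparison:
  fixes U W :: "real^2 \<Rightarrow> real"
  assumes D: "D \<subseteq> V q n - V q 0"
    and "\<And>x. x \<in> D \<Longrightarrow> 2 * U x \<le> Max (U ` nb n x) + Min (U ` nb n x)"
    and "\<And>x. x \<in> D \<Longrightarrow> Max (W ` nb n x) + Min (W ` nb n x) \<le> 2 * W x"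
    and "\<And>x y. x \<in> D \<Longrightarrow> adj q n x y \<Longrightarrow> y \<notin> D \<Longrightarrow> U y \<le> W y"
    and "x \<in> D"
  shows "U x \<le> W x"
proof (rule graph_comparison[where D = D and N = "nb n" and r = "d (q 1)"])
  show "finite D" using D finite_V[of q n] by (meson finite_subset Diff_subset)
  show "\<exists>y\<in>nb n x. d (q 1) y < d (q 1) x" if "x \<in> D" for x
  proof -
    have "q 1 \<in> V q n" "x \<in> V q n" "x \<noteq> q 1"
      using that D V_mono[of 0 n q] by (auto simp: V_0)
    then obtain y where y: "adj q n x y" "d (q 1) y + 1 / 2 ^ n \<le> d (q 1) x"
      using nearer_neighbour by blast
    have "(0::real) < 1 / 2 ^ n" by simp
    then have "d (q 1) y < d (q 1) x" using y(2) by linarith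
    then show ?thesis using y(1) by blast
  qed
qed (use assms finite_nb in auto)

section \<open>Comparison with cones and Lipschitz bounds\<close>

lemma admissibleI:
  assumes "openin (gasket_top q) A" "connected A" "A \<inter> V q 0 = {}"
  shows "admissible q A"
  using assms openin_imp_subset[OF assms(1)] V_subset_gasket[of q 0] V_nonempty[of q 0]
  unfolding admissible_def by blast

lemma comparison_with_cones_uminus:
  assumes "comparison_with_cones q u"
  shows "comparison_with_cones q (\<lambda>x. - u x)"
  unfolding comparison_with_cones_def
proof (intro allI impI)
  fix A x0 l a assume *: "admissible q A" "x0 \<in> gasket q - A" "0 \<le> (l::real)"
  have le: "- u x \<le> l * d x0 x + a \<longleftrightarrow> u x \<ge> - l * d x0 x + (- a)"
    "- u x \<ge> - l * d x0 x + a \<longleftrightarrow> u x \<le> l * d x0 x + (- a)" for x by auto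
  show "((\<forall>x\<in>gasket_top q frontier_of A. - u x \<le> l * d x0 x + a) \<longrightarrow> (\<forall>x\<in>A. - u x \<le> l * d x0 x + a)) \<and>
        ((\<forall>x\<in>gasket_top q frontier_of A. - u x \<ge> - l * d x0 x + a) \<longrightarrow> (\<forall>x\<in>A. - u x \<ge> - l * d x0 x + a))"
    unfolding le using assms * unfolding comparison_with_cones_def by blast
qed

text \<open>Comparison on sets that need not be connected, by passing to a component. This makes sets with
  points removed available without examining their connectedness.\<close>

lemma comparison_from_above:
  assumes u: "comparison_with_cones q u" and A: "openin (gasket_top q) A" "A \<inter> V q 0 = {}"
    and x0: "x0 \<in> gasket q" "x0 \<notin> A" and "0 \<le> l"
    and le: "\<And>y. y \<in> gasket_top q frontier_of A \<Longrightarrow> u y \<le> l * d x0 y + a"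
    and "x \<in> A"
  shows "u x \<le> l * d x0 x + a"
proof -
  obtain C where C: "C \<in> components A" "x \<in> C" using Union_components[of A] \<open>x \<in> A\<close> by blast
  have sub: "C \<subseteq> A" using C in_components_subset by blast
  have "openin (gasket_top q) C"
    using locally_connected_gasket A(1) C(1) unfolding locally_connected_open_component by blast
  then have "admissible q C"
    using C in_components_connected sub A(2) by (intro admissibleI) blast+
  moreover have "x0 \<in> gasket q - C" using x0 sub by blast
  moreover have "\<forall>y\<in>gasket_top q frontier_of C. u y \<le> l * d x0 y + a"
    using frontier_of_component[OF A(1) C(1)] le by blast
  ultimately show ?thesis
    using u \<open>0 \<le> l\<close> C(2) unfolding comparison_with_cones_def by blast
qed

lemma frontier_of_delete:
  assumes A: "openin (gasket_top q) A"
  shows "gasket_top q frontier_of (A - {x}) \<subseteq> gasket_top q frontier_of A \<union> {x}"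
proof -
  have "openin (gasket_top q) (A - {x})" using A by (rule openin_delete)
  then show ?thesis
    using closure_of_mono[of "A - {x}" A "gasket_top q"]
    by (auto simp: frontier_of_openin A)
qed

text \<open>Between \<open>B\<close> and \<open>A\<close> the bound is comparison with the cones centred at the points of \<open>B\<close>. For two
  points of \<open>A\<close> one of them is removed from \<open>A\<close> and becomes the centre; the previous bound controls
  the cone on the frontier of what is left. A set \<open>B\<close> larger than the frontier is allowed because
  this includes vertices of level \<open>0\<close> on the same footing.\<close>

lemma comparison_lipschitz:
  assumes u: "comparison_with_cones q u" and A: "openin (gasket_top q) A" "A \<inter> V q 0 = {}"
    and B: "gasket_top q frontier_of A \<subseteq> B" "B \<subseteq> gasket q - A"
    and L: "0 \<le> L" "\<And>x y. x \<in> B \<Longrightarrow> y \<in> B \<Longrightarrow> \<bar>u x - u y\<bar> \<le> L * d x y"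
    and xy: "x \<in> A \<union> B" "y \<in> A \<union> B"
  shows "\<bar>u x - u y\<bar> \<le> L * d x y"
proof -
  have sub: "A \<subseteq> gasket q" using A(1) by (rule openin_imp_subset)
  have cm: "d x y = d y x" if "x \<in> A \<union> B" "y \<in> A \<union> B" for x y
    using that sub B path_dist_commute by blast
  have out: "v y \<le> v x + L * d x y" 
    if v: "comparison_with_cones q v" "\<And>x y. x \<in> B \<Longrightarrow> y \<in> B \<Longrightarrow> \<bar>v x - v y\<bar> \<le> L * d x y" 
      and x: "x \<in> B" and y: "y \<in> A" for v x y
  proof -
    have "v y \<le> L * d x y + v x"
    proof (rule comparison_from_above[OF v(1) A _ _ L(1) _ y])
      show "v z \<le> L * d x z + v x" if "z \<in> gasket_top q frontier_of A" for z
        using v(2)[of x z] x that B by fastforce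
    qed (use x B in auto)
    then show ?thesis by simp
  qed
  have across: "\<bar>u x - u y\<bar> \<le> L * d x y" if "x \<in> B" "y \<in> A" for x y
  proof -
    have "- u y \<le> - u x + L * d x y"
      using out[OF comparison_with_cones_uminus[OF u] _ that] L(2) by (simp add: abs_minus_commute)
    then show ?thesis using out[OF u L(2) that] by linarith
  qed
  have inside: "u y \<le> u x + L * d x y" if x: "x \<in> A" and y: "y \<in> A" "y \<noteq> x" for x y
  proof -
    have "u y \<le> L * d x y + u x"
    proof (rule comparison_from_above[OF u, of "A - {x}"])
      show "openin (gasket_top q) (A - {x})" using A(1) by (rule openin_delete)
      show "u z \<le> L * d x z + u x" if "z \<in> gasket_top q frontier_of (A - {x})" for z
      proof (cases "z = x")
        case False
        then have "z \<in> B" using frontier_of_delete[OF A(1), of x] that B by blast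
        then show ?thesis using across[of z x] x cm[of z x] by auto
      qed (use x sub in auto)
    qed (use A L x y sub in auto)
    then show ?thesis by simp
  qed
  show ?thesis
  proof (cases "x = y")
    case True then show ?thesis using L(1) by simp
  next
    case False
    consider "x \<in> B" "y \<in> B" | "x \<in> B" "y \<in> A" | "x \<in> A" "y \<in> B" | "x \<in> A" "y \<in> A" using xy by blast
    then show ?thesis
    proof cases
      case 3 then show ?thesis using across[of y x] cm[of x y] by (simp add: abs_minus_commute)
    next
      case 4 then show ?thesis using inside[of x y] inside[of y x] cm[of x y] False by auto
    qed (use L across in auto)
  qed
qed

text \<open>The previous lemma applies to the complement of \<open>V q 0\<close>. On the finite set \<open>V q 0\<close> itself distances
  are at least \<open>1\<close>, so the sum of all differences is a Lipschitz constant.\<close>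

lemma comparison_globally_lipschitz:
  assumes u: "comparison_with_cones q u"
  obtains L where "0 \<le> L" "\<And>x y. x \<in> gasket q \<Longrightarrow> y \<in> gasket q \<Longrightarrow> \<bar>u x - u y\<bar> \<le> L * d x y"
proof -
  define L where "L = (\<Sum>(x, y)\<in>V q 0 \<times> V q 0. \<bar>u x - u y\<bar>)"
  have V0: "V q 0 \<subseteq> gasket q" by (rule V_subset_gasket)
  have L0: "0 \<le> L" unfolding L_def by (intro sum_nonneg) auto
  have on_V0: "\<bar>u x - u y\<bar> \<le> L * d x y" if "x \<in> V q 0" "y \<in> V q 0" for x y
  proof (cases "x = y")
    case False
    then have "1 \<le> d x y"
      using that dist_vertices dist_le_path_dist[of x y] V0 unfolding V_0 by fastforce
    moreover have "\<bar>u x - u y\<bar> \<le> L"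
      unfolding L_def using member_le_sum[of "(x, y)" "V q 0 \<times> V q 0" "\<lambda>(x, y). \<bar>u x - u y\<bar>"] that finite_V[of q 0] by auto
    ultimately show ?thesis using L0 mult_left_mono[of 1 "d x y" L] by linarith
  qed (use L0 in auto)
  have A: "openin (gasket_top q) (gasket q - V q 0)"
    unfolding Diff_eq by (intro openin_open_Int open_Compl finite_imp_closed finite_V)
  have "gasket_top q frontier_of (gasket q - V q 0) \<subseteq> V q 0"
    unfolding frontier_of_openin[OF A] using closure_of_subset_topspace[of "gasket_top q"] by fastforce
  note lip = comparison_lipschitz[OF u A _ this _ L0 on_V0]
  show ?thesis
    by (rule that[OF L0], rule lip) (use V0 in auto)
qed

lemma comparison_continuous:
  assumes u: "comparison_with_cones q u"
  shows "continuous_on (gasket q) u"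
proof -
  obtain L where L: "0 \<le> L" "\<And>x y. x \<in> gasket q \<Longrightarrow> y \<in> gasket q \<Longrightarrow> \<bar>u x - u y\<bar> \<le> L * d x y"
    using comparison_globally_lipschitz[OF u] by blast
  show ?thesis
  proof (rule continuous_on_gasketI)
    fix n x y and w :: "3 list" assume w: "length w = n" "x \<in> cell q w" "y \<in> cell q w"
    then have "\<bar>u x - u y\<bar> \<le> L * d x y" using L(2) cell_subset_gasket by blast
    also have "\<dots> \<le> L * (2 / 2 ^ n)" using path_dist_cell[OF w(2,3)] w(1) L(1) by (intro mult_left_mono) auto
    finally show "\<bar>u x - u y\<bar> \<le> (L * 2) / 2 ^ n" by simp
  qed
qed

section \<open>Absolute minimisers\<close>

lemma Lip_le_iff:
  assumes "0 \<le> L"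
  shows "Lip q f A \<le> ennreal L \<longleftrightarrow>
    (\<forall>x\<in>gasket_top q closure_of A. \<forall>y\<in>gasket_top q closure_of A. \<bar>f x - f y\<bar> \<le> L * d x y)"
proof -
  have sub: "gasket_top q closure_of A \<subseteq> gasket q"
    using closure_of_subset_topspace[of "gasket_top q" A] by simp
  have "\<bar>f y - f x\<bar> / d x y \<le> L \<longleftrightarrow> \<bar>f x - f y\<bar> \<le> L * d x y" if "x \<in> gasket q" "y \<in> gasket q" "x \<noteq> y" for x y
    using path_dist_pos[OF that] by (simp add: pos_divide_le_eq abs_minus_commute)
  then have "Lip q f A \<le> ennreal L \<longleftrightarrow>
    (\<forall>x\<in>gasket_top q closure_of A. \<forall>y\<in>gasket_top q closure_of A. x \<noteq> y \<longrightarrow> \<bar>f x - f y\<bar> \<le> L * d x y)"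
    using sub assms unfolding Lip_def SUP_le_iff by (fastforce simp: ennreal_le_iff)
  then show ?thesis using assms by (metis abs_zero diff_self mult_nonneg_nonneg path_dist_nonneg)
qed

text \<open>A competitor with finite Lipschitz constant \<open>L\<close> makes \<open>u\<close> an \<open>L\<close>-Lipschitz function on the frontier,
  and \<open>comparison_lipschitz\<close> extends this to the closure.\<close>

lemma comparison_imp_AMLE:
  assumes u: "comparison_with_cones q u"
  shows "u \<in> AMLE q"
  unfolding AMLE_def
proof (intro CollectI conjI allI impI comparison_continuous u)
  fix A v assume A: "admissible q A" and uv: "\<forall>x\<in>gasket_top q frontier_of A. u x = v x"
  have op: "openin (gasket_top q) A" "A \<inter> V q 0 = {}" using A by (auto simp: admissible_def)
  have cl: "gasket_top q closure_of A = A \<union> gasket_top q frontier_of A"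
    using closure_of_subset[of A "gasket_top q"] openin_imp_subset[OF op(1)] by (auto simp: frontier_of_openin[OF op(1)])
  show "Lip q u A \<le> Lip q v A"
  proof (cases "Lip q v A")
    case (real L)
    then have v: "\<bar>v x - v y\<bar> \<le> L * d x y" 
      if "x \<in> gasket_top q closure_of A" "y \<in> gasket_top q closure_of A" for x y
      using Lip_le_iff[of L v A] that by auto
    have "\<bar>u x - u y\<bar> \<le> L * d x y" if "x \<in> gasket_top q closure_of A" "y \<in> gasket_top q closure_of A" for x y
    proof (rule comparison_lipschitz[OF u op order_refl])
      show "gasket_top q frontier_of A \<subseteq> gasket q - A"
        using closure_of_subset_topspace[of "gasket_top q" A] by (auto simp: frontier_of_openin[OF op(1)])
      show "\<bar>u x - u y\<bar> \<le> L * d x y" if "x \<in> gasket_top q frontier_of A" "y \<in> gasket_top q frontier_of A" for x y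
        using v[of x y] that uv cl by auto
    qed (use that real cl in auto)
    then show ?thesis using real Lip_le_iff[of L u A] by auto
  qed auto
qed

lemma AMLE_uminus:
  assumes "u \<in> AMLE q" shows "(\<lambda>x. - u x) \<in> AMLE q"
proof -
  have Lip: "Lip q (\<lambda>x. - v x) A = Lip q v A" for v A
    unfolding Lip_def by (simp add: abs_minus_commute)
  have "Lip q (\<lambda>x. - u x) A \<le> Lip q v A"
    if A: "admissible q A" "\<forall>x\<in>gasket_top q frontier_of A. - u x = v x" for A v
  proof -
    have eq: "\<forall>x\<in>gasket_top q frontier_of A. u x = - v x" using A(2) by force
    have "Lip q u A \<le> Lip q w A" if "\<forall>x\<in>gasket_top q frontier_of A. u x = w x" for w
      using assms A(1) that by (simp add: AMLE_def)
    from this[OF eq] have "Lip q u A \<le> Lip q (\<lambda>x. - v x) A" .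
    then show ?thesis by (simp add: Lip)
  qed
  then show ?thesis using assms continuous_on_minus unfolding AMLE_def by blast
qed

text \<open>If the bound fails at \<open>x\<close>, let \<open>C\<close> be the component containing \<open>x\<close> of the open set where \<open>u\<close> exceeds
  the cone. On the frontier of \<open>C\<close> both agree, so minimality gives \<open>u\<close> the Lipschitz constant \<open>l\<close> on \<open>C\<close>.
  A nearly shortest curve from \<open>x\<close> to the centre \<open>x0\<close> leaves \<open>C\<close> at a point where \<open>u\<close> equals the cone, and
  this bounds \<open>u x\<close> by the cone up to an arbitrarily small error.\<close>

lemma AMLE_comparison_from_above:
  assumes u: "u \<in> AMLE q" and A: "admissible q A" and x0: "x0 \<in> gasket q - A" and l: "0 \<le> l"
    and le: "\<And>x. x \<in> gasket_top q frontier_of A \<Longrightarrow> u x \<le> l * d x0 x + a"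
    and x: "x \<in> A"
  shows "u x \<le> l * d x0 x + a"
proof (rule ccontr)
  assume contra: "\<not> u x \<le> l * d x0 x + a"
  define v where "v = (\<lambda>y. l * d x0 y + a)"
  have op: "openin (gasket_top q) A" and AV: "A \<inter> V q 0 = {}" using A by (auto simp: admissible_def)
  have sub: "A \<subseteq> gasket q" using op by (rule openin_imp_subset)
  have cont: "continuous_on (gasket q) (\<lambda>y. u y - v y)"
    using u x0 unfolding v_def AMLE_def by (auto intro!: continuous_intros continuous_on_path_dist)
  define W where "W = A \<inter> {y \<in> gasket q. u y - v y \<in> {0<..}}"
  have W: "openin (gasket_top q) W"
    using continuous_openin_preimage_gen[OF cont, of "{0<..}"] op unfolding W_def vimage_def
    by (intro openin_Int) (auto simp: Int_def)
  have "x \<in> W" using x contra sub by (auto simp: W_def v_def)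
  then obtain C where C: "C \<in> components W" "x \<in> C" using Union_components[of W] by blast
  have CW: "C \<subseteq> W" using C in_components_subset by blast
  have Cop: "openin (gasket_top q) C"
    using locally_connected_gasket W C(1) unfolding locally_connected_open_component by blast
  have Cadm: "admissible q C"
    using C in_components_connected CW AV Cop by (intro admissibleI) (auto simp: W_def)
  have eq: "u y = v y" if "y \<in> gasket_top q frontier_of C" for y
  proof -
    have "y \<in> gasket_top q frontier_of W" using frontier_of_component[OF W C(1)] that by blast
    then have y: "y \<in> gasket_top q closure_of W" "y \<notin> W" by (auto simp: frontier_of_openin[OF W])
    then have yg: "y \<in> gasket q" using closure_of_subset_topspace[of "gasket_top q" W] by auto
    have "closedin (gasket_top q) {y \<in> gasket q. u y - v y \<in> {0..}}"
      using continuous_closedin_preimage[OF cont, of "{0..}"] by (simp add: vimage_def Int_def)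
    then have "gasket_top q closure_of W \<subseteq> {y \<in> gasket q. u y - v y \<in> {0..}}"
      by (rule closure_of_minimal[rotated]) (auto simp: W_def)
    then have ge: "v y \<le> u y" using y by auto
    have "u y \<le> v y"
    proof (cases "y \<in> A")
      case True then show ?thesis using y(2) yg by (auto simp: W_def)
    next
      case False
      then have "y \<in> gasket_top q frontier_of A"
        using y closure_of_mono[of W A "gasket_top q"] by (auto simp: frontier_of_openin[OF op] W_def)
      then show ?thesis using le by (simp add: v_def)
    qed
    with ge show ?thesis by simp
  qed
  have "\<bar>v y - v z\<bar> \<le> l * d y z" if "y \<in> gasket q" "z \<in> gasket q" for y z
  proof -
    have "\<bar>d x0 y - d x0 z\<bar> \<le> d y z"
      using path_dist_triangle[of x0 y z] path_dist_triangle[of x0 z y] path_dist_commute[of y z] that x0 by auto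
    then have "l * \<bar>d x0 y - d x0 z\<bar> \<le> l * d y z" using l by (rule mult_left_mono)
    then show ?thesis using l by (simp add: v_def abs_mult flip: right_diff_distrib)
  qed
  then have "Lip q v C \<le> ennreal l"
    using closure_of_subset_topspace[of "gasket_top q" C] by (subst Lip_le_iff[OF l]) auto
  moreover have "Lip q u C \<le> Lip q v C"
    using u Cadm eq unfolding AMLE_def by blast
  ultimately have uL: "\<bar>u y - u z\<bar> \<le> l * d y z" if "y \<in> gasket_top q closure_of C" "z \<in> gasket_top q closure_of C" for y z
    using Lip_le_iff[OF l, of u C] that by auto
  \<comment> \<open>The error of the curve is chosen such that \<open>l * e\<close> stays below the gap at \<open>x\<close>, also for \<open>l = 0\<close>.\<close>
  define e where "e = (u x - v x) / (l + 1)"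
  have gap: "0 < u x - v x" using contra by (simp add: v_def)
  then have "0 < e" using l by (simp add: e_def)
  have xg: "x \<in> gasket q" using x sub by blast
  have "x0 \<notin> C" using x0 CW by (auto simp: W_def)
  then obtain z where z: "z \<in> gasket_top q frontier_of C" "d x z + d z x0 \<le> d x x0 + e"
    using exit_point[OF C(2) xg _ _ \<open>0 < e\<close>] x0 by blast
  have zc: "z \<in> gasket_top q closure_of C" using z(1) by (simp add: frontier_of_openin[OF Cop])
  then have zg: "z \<in> gasket q" using closure_of_subset_topspace[of "gasket_top q" C] by auto
  have "x \<in> gasket_top q closure_of C"
    using closure_of_subset[of C "gasket_top q"] openin_imp_subset[OF Cop] C(2) by auto
  then have "u x \<le> u z + l * d x z" using uL[OF _ zc] by fastforce
  also have "\<dots> = l * (d x z + d z x0) + a"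
    using eq[OF z(1)] path_dist_commute[of z x0] zg x0 by (simp add: v_def algebra_simps)
  also have "\<dots> \<le> l * (d x x0 + e) + a" using z(2) l by (simp add: mult_left_mono)
  also have "\<dots> = v x + l * e" using path_dist_commute[of x x0] xg x0 by (simp add: v_def algebra_simps)
  finally have "u x - v x \<le> l * e" by simp
  also have "l * e < (l + 1) * e" using \<open>0 < e\<close> by simp
  also have "\<dots> = u x - v x" using l by (simp add: e_def)
  finally show False by simp
qed

text \<open>For a class of functions closed under negation the lower half of comparison with cones follows
  from the upper half.\<close>

lemma comparison_with_conesI:
  assumes P: "P u" "\<And>v. P v \<Longrightarrow> P (\<lambda>x. - v x)"
    and le: "\<And>v A x0 l a x. P v \<Longrightarrow> admissible q A \<Longrightarrow> x0 \<in> gasket q - A \<Longrightarrow> 0 \<le> l \<Longrightarrow>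
      (\<And>y. y \<in> gasket_top q frontier_of A \<Longrightarrow> v y \<le> l * d x0 y + a) \<Longrightarrow> x \<in> A \<Longrightarrow> v x \<le> l * d x0 x + a"
  shows "comparison_with_cones q u"
  unfolding comparison_with_cones_def
proof (intro allI impI conjI ballI)
  fix A x0 x and l a :: real
  assume *: "admissible q A" "x0 \<in> gasket q - A" "0 \<le> l" "x \<in> A"
  show "u x \<le> l * d x0 x + a" if "\<forall>x\<in>gasket_top q frontier_of A. u x \<le> l * d x0 x + a"
    using le[OF P(1) *(1-3) _ *(4)] that by blast
  show "u x \<ge> - l * d x0 x + a" if ge: "\<forall>x\<in>gasket_top q frontier_of A. u x \<ge> - l * d x0 x + a"
  proof -
    have "- u x \<le> l * d x0 x + - a"
    proof (rule le[OF P(2)[OF P(1)] *(1-3) _ *(4)])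
      show "- u y \<le> l * d x0 y + - a" if "y \<in> gasket_top q frontier_of A" for y
        using bspec[OF ge that] by simp
    qed
    then show ?thesis by simp
  qed
qed

lemma AMLE_imp_comparison: "u \<in> AMLE q \<Longrightarrow> comparison_with_cones q u"
  by (rule comparison_with_conesI[where P = "\<lambda>u. u \<in> AMLE q"]) (auto intro: AMLE_uminus AMLE_comparison_from_above)

section \<open>Infinity harmonic functions satisfy comparison with cones\<close>

lemma infinity_harmonic_uminus:
  assumes "infinity_harmonic q u" shows "infinity_harmonic q (\<lambda>x. - u x)"
proof -
  obtain un where un: "\<And>n. graph_infinity_harmonic q n (un n)" "\<And>n x. x \<in> V q 0 \<Longrightarrow> un n x = u x"
    "(\<lambda>n. SUP x\<in>V q n. \<bar>un n x - u x\<bar>) \<longlonglongrightarrow> 0" and cont: "continuous_on (gasket q) u"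
    using assms unfolding infinity_harmonic_def by blast
  have eq: "\<bar>- un n x - - u x\<bar> = \<bar>un n x - u x\<bar>" for n x by simp
  have "(\<lambda>n. SUP x\<in>V q n. \<bar>- un n x - - u x\<bar>) \<longlonglongrightarrow> 0"
    unfolding eq by (rule un(3))
  then show ?thesis
    unfolding infinity_harmonic_def using un cont
    by (intro conjI exI[of _ "\<lambda>n x. - un n x"]) (auto intro: continuous_on_minus graph_infinity_harmonic_uminus)
qed

lemma V_near:
  assumes "x \<in> gasket q"
  obtains y where "y \<in> V q n" "d x y \<le> 1 / 2 ^ n" "dist x y \<le> 1 / 2 ^ n"
proof -
  obtain w where w: "length w = n" "x \<in> cell q w"
    using assms gasket_eq_Union_cells[of q n] by blast
  let ?y = "psi_word q w (q 1)"
  have y: "?y \<in> corners q w" by (simp add: corners_def)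
  then have V: "?y \<in> V q n" using corners_subset_V[of q w] w by blast
  then have yg: "?y \<in> gasket q" using V_subset_gasket by blast
  have "d x ?y \<le> 1 / 2 ^ n"
    using path_dist_corner[OF y w(2)] path_dist_commute[OF assms yg] w(1) by simp
  then show ?thesis using that[OF V] dist_le_path_dist[OF assms yg] by simp
qed

text \<open>If \<open>u\<close> exceeds the cone at \<open>z\<close>, the points of \<open>A\<close> where it does so by a fixed amount form a compact set
  \<open>K\<close>, at positive distance from the rest of the gasket. At a fine level the set \<open>D\<close> of vertices where
  the discrete function exceeds a cone with nearby centre lies in \<open>K\<close>; then all neighbours of \<open>D\<close>
  are in \<open>A\<close>, the centre is not in \<open>D\<close>, and the discrete comparison principle contradicts \<open>D \<noteq> {}\<close>.\<close>

lemma infinity_harmonic_comparison_from_above: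
  assumes u: "infinity_harmonic q u" and A: "admissible q A" and x0: "x0 \<in> gasket q - A" and l: "0 \<le> l"
    and le: "\<And>x. x \<in> gasket_top q frontier_of A \<Longrightarrow> u x \<le> l * d x0 x + a"
    and z: "z \<in> A"
  shows "u z \<le> l * d x0 z + a"
proof (rule ccontr)
  assume contra: "\<not> u z \<le> l * d x0 z + a"
  define C where "C = (\<lambda>y. l * d x0 y + a)"
  \<comment> \<open>At a vertex near \<open>z\<close> one sixth of the gap is lost to each of: moving from \<open>z\<close> to the vertex,
    passing to the discrete function, and moving the centre; the excess defining \<open>D\<close> is the
    remaining half.\<close>
  define \<delta> where "\<delta> = (u z - C z) / 6"
  have \<delta>: "0 < \<delta>" "u z - C z = 6 * \<delta>" using contra by (auto simp: \<delta>_def C_def)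
  have op: "openin (gasket_top q) A" and AV: "A \<inter> V q 0 = {}" using A by (auto simp: admissible_def)
  have sub: "A \<subseteq> gasket q" using op by (rule openin_imp_subset)
  have zg: "z \<in> gasket q" using z sub by blast
  obtain un where un: "\<And>n. graph_infinity_harmonic q n (un n)" 
    "(\<lambda>n. SUP x\<in>V q n. \<bar>un n x - u x\<bar>) \<longlonglongrightarrow> 0" and cont: "continuous_on (gasket q) u"
    using u unfolding infinity_harmonic_def by blast
  have contC: "continuous_on (gasket q) (\<lambda>y. u y - C y)"
    using cont x0 unfolding C_def by (auto intro!: continuous_intros continuous_on_path_dist)
  define K where "K = A \<inter> {y \<in> gasket q. u y - C y \<in> {\<delta>..}}"
  have Keq: "K = gasket_top q closure_of A \<inter> {y \<in> gasket q. u y - C y \<in> {\<delta>..}}"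
  proof -
    have "u y - C y \<le> 0" if "y \<in> gasket_top q closure_of A" "y \<notin> A" for y
      using le[of y] that by (simp add: frontier_of_openin[OF op] C_def)
    then show ?thesis
      using \<delta>(1) closure_of_subset[of A "gasket_top q"] sub unfolding K_def by fastforce
  qed
  have "closedin (gasket_top q) K"
    unfolding Keq using continuous_closedin_preimage[OF contC, of "{\<delta>..}"]
    by (intro closedin_Int closedin_closure_of) (simp add: vimage_def Int_def)
  then have K: "compact K" using compact_gasket closedin_compact by blast
  have "closedin (gasket_top q) (gasket q - A)" using op by (simp add: closedin_diff)
  then have "closed (gasket q - A)" using closed_gasket closedin_closed_trans by blast
  then obtain \<eta> where \<eta>: "0 < \<eta>" "\<And>x y. x \<in> K \<Longrightarrow> y \<in> gasket q - A \<Longrightarrow> \<eta> \<le> dist x y"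
    using separate_compact_closed[OF K, of "gasket q - A"] unfolding K_def by blast
  obtain \<rho>1 where \<rho>1: "0 < \<rho>1" "\<And>y. y \<in> gasket q \<Longrightarrow> dist y z < \<rho>1 \<Longrightarrow> \<bar>(u y - C y) - (u z - C z)\<bar> < \<delta>"
    using contC zg \<delta>(1) unfolding continuous_on_iff dist_real_def by blast
  obtain \<rho>2 where \<rho>2: "0 < \<rho>2" "\<And>y. y \<in> gasket q \<Longrightarrow> dist y z < \<rho>2 \<Longrightarrow> y \<in> A"
    using op z unfolding openin_euclidean_subtopology_iff by blast
  have "\<forall>\<^sub>F n in sequentially. (SUP x\<in>V q n. \<bar>un n x - u x\<bar>) < \<delta>"
    using order_tendstoD(2)[OF un(2) \<delta>(1)] .
  moreover have "\<forall>\<^sub>F n in sequentially. 1 / 2 ^ n < min \<eta> (min \<rho>1 \<rho>2)"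
    using order_tendstoD(2)[OF tendsto_divide_power2, of "min \<eta> (min \<rho>1 \<rho>2)" 1] \<eta>(1) \<rho>1(1) \<rho>2(1) by simp
  moreover have "\<forall>\<^sub>F n in sequentially. l / 2 ^ n < \<delta>"
    using order_tendstoD(2)[OF tendsto_divide_power2 \<delta>(1), of l] .
  ultimately have "\<forall>\<^sub>F n in sequentially. (SUP x\<in>V q n. \<bar>un n x - u x\<bar>) < \<delta> \<and>
      1 / 2 ^ n < min \<eta> (min \<rho>1 \<rho>2) \<and> l / 2 ^ n < \<delta>"
    by eventually_elim simp
  then obtain n where n: "(SUP x\<in>V q n. \<bar>un n x - u x\<bar>) < \<delta>" "1 / 2 ^ n < min \<eta> (min \<rho>1 \<rho>2)" "l / 2 ^ n < \<delta>"
    by (auto simp: eventually_sequentially)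
  have close: "\<bar>un n x - u x\<bar> < \<delta>" if "x \<in> V q n" for x
  proof -
    have "\<bar>un n x - u x\<bar> \<le> (SUP x\<in>V q n. \<bar>un n x - u x\<bar>)"
      using that finite_V[of q n] by (intro cSUP_upper) (auto intro!: bdd_above_finite)
    then show ?thesis using n(1) by linarith
  qed
  \<comment> \<open>Replace the centre of the cone by a vertex; it stays outside \<open>K\<close>.\<close>
  obtain p where p: "p \<in> V q n" "d x0 p \<le> 1 / 2 ^ n" "dist x0 p \<le> 1 / 2 ^ n"
    using V_near[of x0 n] x0 by blast
  then have pg: "p \<in> gasket q" using V_subset_gasket by blast
  have "p \<notin> K" using \<eta>(2)[of p x0] x0 p(3) n(2) by (auto simp: dist_commute)
  define C' where "C' = (\<lambda>y. l * d p y + a)"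
  have CC': "\<bar>C y - C' y\<bar> < \<delta>" if "y \<in> gasket q" for y
  proof -
    have "\<bar>d x0 y - d p y\<bar> \<le> d x0 p"
      using path_dist_triangle[of x0 p y] path_dist_triangle[of p x0 y] path_dist_commute[of x0 p] that x0 pg by auto
    then have "l * \<bar>d x0 y - d p y\<bar> \<le> l * (1 / 2 ^ n)" using l p(2) by (intro mult_left_mono) auto
    then have "\<bar>C y - C' y\<bar> \<le> l / 2 ^ n" using l by (simp add: C_def C'_def abs_mult flip: right_diff_distrib)
    then show ?thesis using n(3) by linarith
  qed
  define D where "D = {x \<in> V q n \<inter> A. un n x > C' x + 3 * \<delta>}"
  have DK: "D \<subseteq> K"
  proof
    fix x assume "x \<in> D"
    then have x: "x \<in> V q n" "x \<in> A" "x \<in> gasket q" "un n x > C' x + 3 * \<delta>" using sub by (auto simp: D_def)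
    have "u x - C x \<ge> \<delta>" using close[OF x(1)] CC'[OF x(3)] x(4) by linarith
    then show "x \<in> K" using x by (auto simp: K_def)
  qed
  obtain z' where z': "z' \<in> V q n" "dist z z' \<le> 1 / 2 ^ n" using V_near[OF zg, of n] by blast
  have z'g: "z' \<in> gasket q" using z' V_subset_gasket by blast
  have "dist z' z < min \<eta> (min \<rho>1 \<rho>2)" using z'(2) n(2) by (simp only: dist_commute)
  then have "z' \<in> A" "\<bar>(u z' - C z') - (u z - C z)\<bar> < \<delta>" using \<rho>1(2) \<rho>2(2) z'g by auto
  then have "un n z' > C' z' + 3 * \<delta>"
    using close[OF z'(1)] CC'[OF z'g] \<delta>(2) by linarith
  then have "z' \<in> D" using z' \<open>z' \<in> A\<close> by (simp add: D_def)
  have "un n z' \<le> l * d p z' + (a + 3 * \<delta>)"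
  proof (rule V_comparison[OF _ _ _ _ \<open>z' \<in> D\<close>])
    show "D \<subseteq> V q n - V q 0" using AV by (auto simp: D_def)
    then show "2 * un n x \<le> Max (un n ` nb n x) + Min (un n ` nb n x)" if "x \<in> D" for x
      using un(1)[of n] that unfolding graph_infinity_harmonic_iff by fastforce
    show "Max ((\<lambda>x. l * d p x + (a + 3 * \<delta>)) ` nb n x) + Min ((\<lambda>x. l * d p x + (a + 3 * \<delta>)) ` nb n x)
        \<le> 2 * (l * d p x + (a + 3 * \<delta>))" if "x \<in> D" for x
    proof (rule cone_supersolution[OF p(1) _ _ l])
      show "x \<in> V q n" using that by (simp add: D_def)
      show "x \<noteq> p" using that DK \<open>p \<notin> K\<close> by blast
    qed
    show "un n y \<le> l * d p y + (a + 3 * \<delta>)" if "x \<in> D" "adj q n x y" "y \<notin> D" for x y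
    proof -
      have "dist x y < \<eta>" using adj_dist[OF that(2)] n(2) by simp
      then have "y \<in> A" using \<eta>(2)[of x y] that DK adj_gasket[OF that(2)] by fastforce
      then show ?thesis using that(3) adj_V[OF that(2)] by (simp add: D_def C'_def)
    qed
  qed
  with \<open>un n z' > C' z' + 3 * \<delta>\<close> show False by (simp add: C'_def)
qed

lemma infinity_harmonic_imp_comparison: "infinity_harmonic q u \<Longrightarrow> comparison_with_cones q u"
  by (rule comparison_with_conesI[where P = "infinity_harmonic q"])
    (auto intro: infinity_harmonic_uminus infinity_harmonic_comparison_from_above)

section \<open>Comparison with cones gives discrete infinity subharmonicity\<close>

text \<open>The maximum over the sphere of one edge length in the graph, in the role of the maximum over a small
  ball in the theory on Euclidean domains.\<close>

definition nbmax :: "nat \<Rightarrow> (real^2 \<Rightarrow> real) \<Rightarrow> real^2 \<Rightarrow> real" where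
  "nbmax n u x = Max (u ` nb n x)"

lemma le_nbmax: "adj q n x y \<Longrightarrow> u y \<le> nbmax n u x"
  unfolding nbmax_def using finite_nb by (intro Max_ge) auto

lemma star_Int_V0: 
  assumes "x \<in> V q n - V q 0" shows "star n x \<inter> V q 0 = {}"
  using assms star_Int_V V_mono[of 0 n q] by blast

text \<open>This is the maximum principle on the star, that is, comparison with the cone of slope \<open>0\<close>.\<close>

lemma self_le_nbmax:
  assumes u: "comparison_with_cones q u" and x: "x \<in> V q n - V q 0"
  shows "u x \<le> nbmax n u x"
proof -
  have q1: "q 1 \<in> gasket q" "q 1 \<notin> star n x"
    using star_Int_V0[OF x] vertex_in_gasket by (auto simp: V_0)
  have "u x \<le> 0 * d (q 1) x + nbmax n u x"
  proof (rule comparison_from_above[OF u openin_star star_Int_V0[OF x] q1])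
    show "u y \<le> 0 * d (q 1) y + nbmax n u x" if "y \<in> gasket_top q frontier_of star n x" for y
      using frontier_of_star[of x n] that x le_nbmax by auto
    show "x \<in> star n x" using x in_star V_subset_gasket by blast
  qed simp
  then show ?thesis by simp
qed

lemma path_dist_ge_two_steps:
  assumes "x \<in> V q n" "z \<in> V q n" "z \<noteq> x" "\<not> adj q n x z"
  shows "2 / 2 ^ n \<le> d x z"
proof -
  obtain y where y: "adj q n z y" "d x y + 1 / 2 ^ n \<le> d x z"
    using nearer_neighbour[OF assms(1-3)] by blast
  then have "y \<noteq> x" using assms(4) adj_commute by blast
  then obtain y' where "d x y' + 1 / 2 ^ n \<le> d x y"
    using nearer_neighbour[OF assms(1) adj_V(2)[OF y(1)]] by blast
  then show ?thesis using y(2) path_dist_nonneg[of x y'] by linarith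
qed

text \<open>Let \<open>M\<close> be the maximum of \<open>u\<close> over the ends of walks of two edges from \<open>x\<close>. On the union \<open>S\<close> of the
  stars of \<open>x\<close> and its neighbours, with \<open>x\<close> removed, \<open>u\<close> lies below the cone at \<open>x\<close> that has the value \<open>u x\<close> at
  \<open>x\<close> and \<open>M\<close> at distance two edges, since the frontier of \<open>S\<close> is at least that far away. At the
  neighbours, halfway, this gives \<open>2 * nbmax n u x \<le> u x + M\<close>, and \<open>u x\<close> is at most \<open>nbmax n u y\<close> for
  each neighbour \<open>y\<close>.\<close>

lemma nbmax_subharmonic:
  assumes u: "comparison_with_cones q u" and x: "x \<in> V q n - V q 0" and inner: "nb n x \<inter> V q 0 = {}"
  shows "2 * nbmax n u x \<le> Max (nbmax n u ` nb n x) + Min (nbmax n u ` nb n x)"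
proof -
  have xV: "x \<in> V q n" and xg: "x \<in> gasket q" using x V_subset_gasket by blast+
  have fin: "finite (nb n x)" "nb n x \<noteq> {}" using finite_nb nb_nonempty[OF xV] by blast+
  have nbV: "y \<in> V q n - V q 0" if "adj q n x y" for y using that inner adj_V by blast
  define M where "M = Max (nbmax n u ` nb n x)"
  have M: "nbmax n u y \<le> M" if "adj q n x y" for y
    unfolding M_def using fin that by (intro Max_ge) auto
  have ux: "u x \<le> nbmax n u y" if "adj q n x y" for y
    using le_nbmax[of n y x] that adj_commute by blast
  obtain y0 where y0: "adj q n x y0" using fin by blast
  \<comment> \<open>The slope that climbs from \<open>u x\<close> to \<open>M\<close> over two edges.\<close>
  define l where "l = (M - u x) * 2 ^ n / 2"
  have l: "0 \<le> l" using ux[OF y0] M[OF y0] by (simp add: l_def)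
  define S where "S = star n x \<union> (\<Union>y\<in>nb n x. star n y)"
  have S: "openin (gasket_top q) S" unfolding S_def by (intro openin_Un openin_Union) (auto intro: openin_star)
  have S0: "S \<inter> V q 0 = {}" unfolding S_def using star_Int_V0[OF x] star_Int_V0[OF nbV] by auto
  have xS: "x \<in> S" "\<And>y. adj q n x y \<Longrightarrow> y \<in> S"
    unfolding S_def using in_star xg adj_gasket by auto
  have frS: "z \<in> V q n \<and> u z \<le> M \<and> 2 / 2 ^ n \<le> d x z" if "z \<in> gasket_top q frontier_of S" for z
  proof -
    have z: "z \<in> gasket_top q closure_of S" "z \<notin> S" using that by (auto simp: frontier_of_openin[OF S])
    have "gasket_top q closure_of S = gasket_top q closure_of star n x \<union> (\<Union>y\<in>nb n x. gasket_top q closure_of star n y)"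
      unfolding S_def using fin(1) by (simp add: closure_of_Un closure_of_Union[of "_ ` _"])
    then obtain y where y: "y = x \<or> adj q n x y" "z \<in> gasket_top q closure_of star n y" using z by auto
    moreover have "z \<notin> star n y" using y(1) z(2) by (auto simp: S_def)
    ultimately have "adj q n y z"
      using frontier_of_star[of y n] nbV xV by (auto simp: frontier_of_openin[OF openin_star])
    moreover have "z \<noteq> x" "\<not> adj q n x z" using xS z(2) by blast+
    ultimately show ?thesis
      using y(1) adj_V[of n y z] path_dist_ge_two_steps[OF xV] le_nbmax[of n y z u] M[of y] by fastforce
  qed
  have cone: "u y \<le> l * d x y + u x" if y: "adj q n x y" for y
  proof (rule comparison_from_above[OF u])
    show "openin (gasket_top q) (S - {x})" using S by (rule openin_delete)
    show "(S - {x}) \<inter> V q 0 = {}" using S0 by blast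
    show "u z \<le> l * d x z + u x" if "z \<in> gasket_top q frontier_of (S - {x})" for z
    proof (cases "z = x")
      case False
      then have z: "u z \<le> M" "2 / 2 ^ n \<le> d x z"
        using frS frontier_of_delete[OF S, of x] that by blast+
      have "M - u x = l * (2 / 2 ^ n)" by (simp add: l_def)
      also have "\<dots> \<le> l * d x z" using z(2) l by (rule mult_left_mono)
      finally show ?thesis using z(1) by simp
    qed (use l xg in auto)
    show "y \<in> S - {x}" using xS y by (auto simp: adj_iff)
  qed (use xg l in auto)
  have "nbmax n u x \<le> (u x + M) / 2"
    unfolding nbmax_def
  proof (rule Max.boundedI)
    fix c assume "c \<in> u ` nb n x"
    then obtain y where y: "adj q n x y" "c = u y" by auto
    have "l * d x y \<le> l * (1 / 2 ^ n)" using adj_path_dist[OF y(1)] l by (rule mult_left_mono)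
    also have "\<dots> = (M - u x) / 2" by (simp add: l_def)
    finally show "c \<le> (u x + M) / 2" using cone[OF y(1)] y(2) by (simp add: field_simps)
  qed (use fin in auto)
  then have "2 * nbmax n u x \<le> M + u x" by (simp add: field_simps)
  also have "u x \<le> Min (nbmax n u ` nb n x)"
    using fin ux by (intro Min.boundedI) auto
  finally show ?thesis by (simp add: M_def)
qed

section \<open>Convergence of the discrete problems\<close>

text \<open>Negated, this is comparison of the infinity harmonic function \<open>- f\<close> with the superharmonic cone at \<open>p\<close>.\<close>

lemma graph_harmonic_ge_cone:
  assumes f: "graph_infinity_harmonic q n f" and p: "p \<in> V q 0"
    and L: "0 \<le> L" "\<And>y. y \<in> V q 0 \<Longrightarrow> f p - L * d p y \<le> f y" and x: "x \<in> V q n"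
  shows "f p - L * d p x \<le> f x"
proof (cases "x \<in> V q 0")
  case False
  have pV: "p \<in> V q n" using p V_mono[of 0 n q] by blast
  have "- f x \<le> L * d p x + (- f p)"
  proof (rule V_comparison[where D = "V q n - V q 0" and U = "\<lambda>x. - f x" and W = "\<lambda>x. L * d p x + (- f p)"])
    show "2 * - f x \<le> Max ((\<lambda>x. - f x) ` nb n x) + Min ((\<lambda>x. - f x) ` nb n x)" if "x \<in> V q n - V q 0" for x
      using graph_infinity_harmonic_uminus[OF f] that unfolding graph_infinity_harmonic_iff by fastforce
    show "Max ((\<lambda>x. L * d p x + - f p) ` nb n x) + Min ((\<lambda>x. L * d p x + - f p) ` nb n x) \<le> 2 * (L * d p x + - f p)"
      if "x \<in> V q n - V q 0" for x
      using that p by (intro cone_supersolution pV L(1)) auto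
    show "- f y \<le> L * d p y + - f p" if "adj q n x y" "y \<notin> V q n - V q 0" for x y
      using L(2)[of y] adj_V[OF that(1)] that(2) by auto
  qed (use x False in auto)
  then show ?thesis by simp
qed (use L in auto)

text \<open>At interior vertices without neighbour in \<open>V q 0\<close> this is the comparison principle for the subharmonic
  function \<open>nbmax n u\<close>. At the vertices next to some \<open>p \<in> V q 0\<close> both sides are close to \<open>u p\<close>: two edges
  are lost between \<open>nbmax n u\<close> and \<open>u p\<close>, and one edge between \<open>u p\<close> and \<open>f\<close>, whence the factor \<open>3\<close>.\<close>

lemma comparison_le_graph_harmonic:
  assumes u: "comparison_with_cones q u" and f: "graph_infinity_harmonic q n f"
    and fu: "\<And>x. x \<in> V q 0 \<Longrightarrow> f x = u x"
    and L: "0 \<le> L" "\<And>x y. x \<in> gasket q \<Longrightarrow> y \<in> gasket q \<Longrightarrow> \<bar>u x - u y\<bar> \<le> L * d x y"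
    and x: "x \<in> V q n"
  shows "u x \<le> f x + 3 * L / 2 ^ n"
proof -
  define h :: real where "h = 1 / 2 ^ n"
  have h: "0 \<le> L * h" using L(1) by (simp add: h_def)
  have u_adj: "\<bar>u x - u y\<bar> \<le> L * h" if "adj q n x y" for x y
    using L(2)[of x y] adj_gasket[OF that] mult_left_mono[OF adj_path_dist[OF that] L(1)] by (simp add: h_def)
  have f_adj: "u p - L * h \<le> f y" if "p \<in> V q 0" "adj q n p y" for p y
  proof -
    have pg: "p \<in> gasket q" using that adj_gasket by blast
    have "f p - L * d p y \<le> f y"
    proof (rule graph_harmonic_ge_cone[OF f that(1) L(1) _ adj_V(2)[OF that(2)]])
      show "f p - L * d p z \<le> f z" if "z \<in> V q 0" for z
        using L(2)[OF pg, of z] fu[OF that] fu[OF \<open>p \<in> V q 0\<close>] V_subset_gasket[of q 0] that by fastforce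
    qed
    then show ?thesis using mult_left_mono[OF adj_path_dist[OF that(2)] L(1)] fu[OF that(1)] by (simp add: h_def)
  qed
  define D where "D = {x \<in> V q n - V q 0. nb n x \<inter> V q 0 = {}}"
  have inD: "nbmax n u x \<le> f x + 3 * (L * h)" if "x \<in> D" for x
  proof (rule V_comparison[OF _ _ _ _ that])
    show "D \<subseteq> V q n - V q 0" by (auto simp: D_def)
    show "2 * nbmax n u x \<le> Max (nbmax n u ` nb n x) + Min (nbmax n u ` nb n x)" if "x \<in> D" for x
      using nbmax_subharmonic[OF u] that by (auto simp: D_def)
    show "Max ((\<lambda>x. f x + 3 * (L * h)) ` nb n x) + Min ((\<lambda>x. f x + 3 * (L * h)) ` nb n x) \<le> 2 * (f x + 3 * (L * h))"
      if "x \<in> D" for x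
    proof -
      have ne: "nb n x \<noteq> {}" using that nb_nonempty by (auto simp: D_def)
      have "Max (f ` nb n x) + Min (f ` nb n x) = 2 * f x"
        using f that unfolding graph_infinity_harmonic_iff D_def by blast
      then show ?thesis
        unfolding Max_add_commute[OF finite_nb ne] Min_add_commute[OF finite_nb ne] by simp
    qed
    show "nbmax n u y \<le> f y + 3 * (L * h)" if xy: "x \<in> D" "adj q n x y" "y \<notin> D" for x y
    proof -
      have yV: "y \<in> V q n" using adj_V xy by blast
      have "y \<notin> V q 0" using xy(1,2) by (auto simp: D_def)
      then obtain p where p: "p \<in> V q 0" "adj q n p y" using xy(3) yV adj_commute by (auto simp: D_def)
      have "nbmax n u y \<le> u p + 2 * (L * h)"
        unfolding nbmax_def
      proof (rule Max.boundedI)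
        fix c assume "c \<in> u ` nb n y"
        then obtain z where z: "adj q n y z" "c = u z" by auto
        show "c \<le> u p + 2 * (L * h)" using u_adj[OF z(1)] u_adj[OF p(2)] z(2) by linarith
      qed (use finite_nb nb_nonempty[OF yV] in auto)
      then show ?thesis using f_adj[OF p] by linarith
    qed
  qed
  consider "x \<in> V q 0" | "x \<in> D" | p where "p \<in> V q 0" "adj q n p x"
    using x adj_commute by (auto simp: D_def)
  then have "u x \<le> f x + 3 * (L * h)"
  proof cases
    case 1 then show ?thesis using fu h by simp
  next
    case 2
    then show ?thesis using inD[OF 2] self_le_nbmax[OF u, of x n] by (force simp: D_def)
  next
    case 3
    then show ?thesis using f_adj[OF 3] u_adj[OF 3(2)] h by linarith
  qed
  then show ?thesis by (simp add: h_def)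
qed

lemma comparison_imp_infinity_harmonic:
  assumes u: "comparison_with_cones q u"
  shows "infinity_harmonic q u"
proof -
  have "\<forall>n. \<exists>f. graph_infinity_harmonic q n f \<and> (\<forall>x\<in>V q 0. f x = u x)"
    by (meson graph_harmonic_extension)
  then obtain un where un: "\<And>n. graph_infinity_harmonic q n (un n)" "\<And>n x. x \<in> V q 0 \<Longrightarrow> un n x = u x"
    by metis
  obtain L where L: "0 \<le> L" "\<And>x y. x \<in> gasket q \<Longrightarrow> y \<in> gasket q \<Longrightarrow> \<bar>u x - u y\<bar> \<le> L * d x y"
    using comparison_globally_lipschitz[OF u] by blast
  have bound: "\<bar>un n x - u x\<bar> \<le> 3 * L / 2 ^ n" if x: "x \<in> V q n" for n x
  proof -
    have "u x \<le> un n x + 3 * L / 2 ^ n"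
      by (rule comparison_le_graph_harmonic[OF u un(1) un(2) L x])
    moreover have "- u x \<le> - un n x + 3 * L / 2 ^ n"
    proof (rule comparison_le_graph_harmonic[OF comparison_with_cones_uminus[OF u]
          graph_infinity_harmonic_uminus[OF un(1)] _ L(1) _ x])
      show "\<bar>- u x - - u y\<bar> \<le> L * d x y" if "x \<in> gasket q" "y \<in> gasket q" for x y
        using L(2)[OF that] by (simp add: abs_minus_commute)
    qed (simp add: un)
    ultimately show ?thesis by linarith
  qed
  have "(\<lambda>n. SUP x\<in>V q n. \<bar>un n x - u x\<bar>) \<longlonglongrightarrow> 0"
  proof (rule tendsto_sandwich[OF _ _ tendsto_const tendsto_divide_power2[of "3 * L"]])
    show "\<forall>\<^sub>F n in sequentially. 0 \<le> (SUP x\<in>V q n. \<bar>un n x - u x\<bar>)"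
    proof (intro always_eventually allI)
      fix n
      obtain x where "x \<in> V q n" using V_nonempty by blast
      then have "\<bar>un n x - u x\<bar> \<le> (SUP x\<in>V q n. \<bar>un n x - u x\<bar>)"
        using finite_V[of q n] by (intro cSUP_upper) (auto intro!: bdd_above_finite)
      then show "0 \<le> (SUP x\<in>V q n. \<bar>un n x - u x\<bar>)" by linarith
    qed
    show "\<forall>\<^sub>F n in sequentially. (SUP x\<in>V q n. \<bar>un n x - u x\<bar>) \<le> 3 * L / 2 ^ n"
      using bound V_nonempty by (intro always_eventually allI cSUP_least) auto
  qed
  then show ?thesis
    unfolding infinity_harmonic_def using comparison_continuous[OF u] un by blast
qed

end

theorem corollary4p5:
  fixes q :: "3 \<Rightarrow> real^2" and u :: "real^2 \<Rightarrow> real"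
  assumes "unit_equilateral q"
  shows "(u \<in> AMLE q \<longleftrightarrow> comparison_with_cones q u) \<and>
         (comparison_with_cones q u \<longleftrightarrow> infinity_harmonic q u)"
proof -
  interpret sierpinski q by unfold_locales (rule assms)
  show ?thesis
    using AMLE_imp_comparison comparison_imp_AMLE infinity_harmonic_imp_comparison
      comparison_imp_infinity_harmonic by blast
qed

end
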